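(* Let $\Omega$ be a set of cardinality $d\ge3$. Let $H\le\mathrm{Aut}(T_d)$ be non-discrete, locally permutation isomorphic to $F\le\mathrm{Sym}(\Omega)$ and contain an involutive inversion. Suppose that $F$ is transitive and that every non-trivial subnormal subgroup of $F_\omega$ $(\omega\in\Omega)$ is transitive on $\Omega\setminus\{\omega\}$. If $H^{(P_k)}\neq H^{(P_l)}$ for some $k,l\in\mathbb{N}$, then $(H^{(P_k)})^{+_k}$ and $(H^{(P_l)})^{+_l}$ are non-isomorphic as topological groups.
   Context: $T_d=(V,E)$ is the $d$-regular tree (Serre's convention: $E$ consists of oriented edges with inversion $e\mapsto\overline e$; $E(x)$ is the set of edges with origin $x$). $\mathrm{Aut}(T_d)$ and its subgroups carry the permutation topology for the action on $V\cup E$ (basic open sets prescribe the images of finitely many points). An inversion is an automorphism mapping some edge $e$ to $\overline e$; it is involutive if it has order $2$. $H$ is locally permutation isomorphic to $F$ if for every $x\in V$ the permutation group induced by the stabilizer $H_x$ on $E(x)$ is permutation isomorphic to $F\le\mathrm{Sym}(\Omega)$. $F_\omega$ is the stabilizer of $\omega$ in $F$. For $k\in\mathbb{N}=\{1,2,\dots\}$, the $(P_k)$-closure of $H\le\mathrm{Aut}(T_d)$ is $$H^{(P_k)}=\{g\in\mathrm{Aut}(T_d)\mid\forall x\in V\ \exists h\in H:\ g|_{B(x,k)}=h|_{B(x,k)}\},$$ where $B(x,k)$ is the ball of radius $k$ around $x$. For $G\le\mathrm{Aut}(T_d)$, $G^{+_k}:=\langle G_{e^{k-1}}\mid e\in E\rangle$,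 where $e^{k-1}$ is the subtree spanned by all vertices at distance at most $k-1$ from the edge $e$ and $G_{e^{k-1}}$ is its pointwise stabilizer in $G$. *)

theory Defs
  imports
    "HOL-Algebra.Generated_Groups"
    "HOL-Algebra.Multiplicative_Group"
    "HOL-Algebra.Bij"
    "HOL-Analysis.Analysis"
    "Graph_Theory.Digraph_Component"
    "Graph_Theory.Bidirected_Digraph"
begin

section \<open>Regular trees\<close>

text \<open>A graph in the sense of Serre is a \<^locale>\<open>bidirected_digraph\<close>: a directed
  multigraph with a fixed-point free inversion \<open>arev\<close> of its arcs that exchanges origin
  (\<open>tail\<close>) and terminus (\<open>head\<close>).\<close>

text \<open>The library predicate \<open>forest\<close> excludes every directed cycle, hence also the
  backtracking walk \<open>e, arev e\<close>, which is not a circuit in the sense of Serre. All other simple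
  closed walks (loops, double edges, longer cycles) are circuits.\<close>

definition circuit :: "('v, 'e) pre_digraph \<Rightarrow> ('e \<Rightarrow> 'e) \<Rightarrow> 'e list \<Rightarrow> bool" where
  "circuit T arev p \<longleftrightarrow> pre_digraph.cycle T p \<and> (\<forall>e. p \<noteq> [e, arev e])"

text \<open>Paths run along oriented edges and each edge is present in both orientations, so
  connectedness is \<^const>\<open>strongly_connected\<close> (which includes non-emptiness).\<close>

locale regular_tree = bidirected_digraph T arev
  for T :: "('v, 'e) pre_digraph" and arev :: "'e \<Rightarrow> 'e" +
  fixes d :: nat
  assumes connected_tree: "strongly_connected T"
    and no_circuit: "\<not> circuit T arev p"
    and regular: "x \<in> verts T \<Longrightarrow> finite (out_arcs T x) \<and> card (out_arcs T x) = d"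

definition vdist :: "('v, 'e) pre_digraph \<Rightarrow> 'v \<Rightarrow> 'v \<Rightarrow> nat" where
  "vdist T u v = (LEAST n. \<exists>p. pre_digraph.awalk T u p v \<and> length p = n)"

definition ball_graph :: "('v, 'e) pre_digraph \<Rightarrow> 'v \<Rightarrow> nat \<Rightarrow> ('v, 'e) pre_digraph" where
  "ball_graph T x k = T \<restriction> {v \<in> verts T. vdist T x v \<le> k}"

definition edge_nbhd :: "('v, 'e) pre_digraph \<Rightarrow> 'e \<Rightarrow> nat \<Rightarrow> ('v, 'e) pre_digraph" where
  "edge_nbhd T e k =
     T \<restriction> {v \<in> verts T. vdist T (tail T e) v \<le> k \<or> vdist T (head T e) v \<le> k}"


section \<open>The automorphism group and its permutation topology\<close>

text \<open>An automorphism is a pair \<open>g\<close>: \<open>fst g\<close> acts on the vertices and \<open>snd g\<close> on the oriented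
  edges. The elements of \<^const>\<open>Bij\<close> are extensional, so distinct pairs act differently.\<close>

definition aut :: "('v, 'e) pre_digraph \<Rightarrow> ('e \<Rightarrow> 'e) \<Rightarrow> (('v \<Rightarrow> 'v) \<times> ('e \<Rightarrow> 'e)) set" where
  "aut T arev = {g. fst g \<in> Bij (verts T) \<and> snd g \<in> Bij (arcs T) \<and>
     (\<forall>e \<in> arcs T. tail T (snd g e) = fst g (tail T e) \<and>
                   head T (snd g e) = fst g (head T e) \<and>
                   snd g (arev e) = arev (snd g e))}"

definition aut_group ::
  "('v, 'e) pre_digraph \<Rightarrow> ('e \<Rightarrow> 'e) \<Rightarrow> (('v \<Rightarrow> 'v) \<times> ('e \<Rightarrow> 'e)) monoid" where
  "aut_group T arev =
     (BijGroup (verts T) \<times>\<times> BijGroup (arcs T)) \<lparr>carrier := aut T arev\<rparr>"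

lemma group_aut_group:
  assumes "bidirected_digraph T arev"
  shows "group (aut_group T arev)"
proof -
  interpret T: bidirected_digraph T arev by (fact assms)
  let ?P = "BijGroup (verts T) \<times>\<times> BijGroup (arcs T)"
  have P: "group ?P"
    by (intro DirProd_group group_BijGroup)
  have "subgroup (aut T arev) ?P"
  proof (rule group.subgroupI[OF P])
    show sub: "aut T arev \<subseteq> carrier ?P"
      by (auto simp: aut_def BijGroup_def)
    have "(\<lambda>x \<in> verts T. x, \<lambda>e \<in> arcs T. e) \<in> aut T arev"
      using id_Bij[of "verts T"] id_Bij[of "arcs T"] by (auto simp: aut_def)
    then show "aut T arev \<noteq> {}" by blast
    show "g \<otimes>\<^bsub>?P\<^esub> h \<in> aut T arev" if "g \<in> aut T arev" "h \<in> aut T arev" for g h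
    proof -
      obtain g1 g2 h1 h2 where [simp]: "g = (g1, g2)" "h = (h1, h2)" by (cases g, cases h)
      have B: "g1 \<in> Bij (verts T)" "g2 \<in> Bij (arcs T)" "h1 \<in> Bij (verts T)" "h2 \<in> Bij (arcs T)"
        using that by (auto simp: aut_def)
      then have "h2 e \<in> arcs T" if "e \<in> arcs T" for e
        using that Bij_imp_funcset by fastforce
      with that B show ?thesis
        by (auto simp: aut_def BijGroup_def compose_Bij compose_eq)
    qed
    show "inv\<^bsub>?P\<^esub> g \<in> aut T arev" if "g \<in> aut T arev" for g
    proof -
      obtain g1 g2 where [simp]: "g = (g1, g2)" by (cases g)
      have B: "g1 \<in> Bij (verts T)" "g2 \<in> Bij (arcs T)"
        using that by (auto simp: aut_def)
      have inv: "inv\<^bsub>?P\<^esub> g =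
          (restrict (inv_into (verts T) g1) (verts T), restrict (inv_into (arcs T) g2) (arcs T))"
        using B inv_DirProd[OF group_BijGroup group_BijGroup, of g1 "verts T" g2 "arcs T"]
        by (simp add: inv_BijGroup) (simp add: BijGroup_def)
      have "tail T (inv_into (arcs T) g2 e) = inv_into (verts T) g1 (tail T e) \<and>
            head T (inv_into (arcs T) g2 e) = inv_into (verts T) g1 (head T e) \<and>
            inv_into (arcs T) g2 (arev e) = arev (inv_into (arcs T) g2 e)"
        if e: "e \<in> arcs T" for e
      proof -
        have i1: "inj_on g1 (verts T)" and i2: "inj_on g2 (arcs T)" and s2: "g2 ` arcs T = arcs T"
          using B by (auto simp: Bij_def bij_betw_def)
        obtain f where f: "f \<in> arcs T" "e = g2 f" using s2 e by blast
        have "tail T e = g1 (tail T f)" "head T e = g1 (head T f)" "arev e = g2 (arev f)"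
          using \<open>g \<in> aut T arev\<close> f by (auto simp: aut_def)
        then show ?thesis
          using f i1 i2 by (simp add: inv_into_f_f)
      qed
      then show ?thesis
        unfolding inv using B by (auto simp: aut_def restrict_inv_into_Bij)
    qed
  qed
  then show ?thesis
    unfolding aut_group_def by (rule group.subgroup_imp_group[OF P])
qed

definition perm_topology ::
  "('v, 'e) pre_digraph \<Rightarrow> (('v \<Rightarrow> 'v) \<times> ('e \<Rightarrow> 'e)) set \<Rightarrow> (('v \<Rightarrow> 'v) \<times> ('e \<Rightarrow> 'e)) topology" where
  "perm_topology T H = topology_generated_by
     {{h \<in> H. (\<forall>v \<in> A. fst h v = p v) \<and> (\<forall>e \<in> B. snd h e = q e)} | A B p q.
        finite A \<and> A \<subseteq> verts T \<and> finite B \<and> B \<subseteq> arcs T}"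

definition top_group_isomorphic ::
  "('a, 'm) monoid_scheme \<Rightarrow> 'a topology \<Rightarrow> ('b, 'n) monoid_scheme \<Rightarrow> 'b topology \<Rightarrow> bool" where
  "top_group_isomorphic G1 X1 G2 X2 \<longleftrightarrow> (\<exists>\<phi> \<in> iso G1 G2. homeomorphic_map X1 X2 \<phi>)"

definition involutive_inversion ::
  "('v, 'e) pre_digraph \<Rightarrow> ('e \<Rightarrow> 'e) \<Rightarrow> ('v \<Rightarrow> 'v) \<times> ('e \<Rightarrow> 'e) \<Rightarrow> bool" where
  "involutive_inversion T arev g \<longleftrightarrow>
     g \<in> aut T arev \<and> (\<exists>e \<in> arcs T. snd g e = arev e) \<and> group.ord (aut_group T arev) g = 2"


section \<open>Closures and the subgroups generated by edge-neighbourhood fixators\<close>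

definition agree_on :: "('v, 'e) pre_digraph \<Rightarrow>
  ('v \<Rightarrow> 'v) \<times> ('e \<Rightarrow> 'e) \<Rightarrow> ('v \<Rightarrow> 'v) \<times> ('e \<Rightarrow> 'e) \<Rightarrow> bool" where
  "agree_on S g h \<longleftrightarrow> (\<forall>v \<in> verts S. fst g v = fst h v) \<and> (\<forall>e \<in> arcs S. snd g e = snd h e)"

definition Pk_closure :: "('v, 'e) pre_digraph \<Rightarrow> ('e \<Rightarrow> 'e) \<Rightarrow> nat \<Rightarrow>
  (('v \<Rightarrow> 'v) \<times> ('e \<Rightarrow> 'e)) set \<Rightarrow> (('v \<Rightarrow> 'v) \<times> ('e \<Rightarrow> 'e)) set" where
  "Pk_closure T arev k H =
     {g \<in> aut T arev. \<forall>x \<in> verts T. \<exists>h \<in> H. agree_on (ball_graph T x k) g h}"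

definition pointwise_stab :: "('v, 'e) pre_digraph \<Rightarrow>
  (('v \<Rightarrow> 'v) \<times> ('e \<Rightarrow> 'e)) set \<Rightarrow> (('v \<Rightarrow> 'v) \<times> ('e \<Rightarrow> 'e)) set" where
  "pointwise_stab S G = {g \<in> G. (\<forall>v \<in> verts S. fst g v = v) \<and> (\<forall>e \<in> arcs S. snd g e = e)}"

text \<open>Meaningful for \<open>k \<ge> 1\<close> only: \<open>k - 1\<close> truncates at \<open>k = 0\<close>.\<close>

definition plus_k :: "('v, 'e) pre_digraph \<Rightarrow> ('e \<Rightarrow> 'e) \<Rightarrow> nat \<Rightarrow>
  (('v \<Rightarrow> 'v) \<times> ('e \<Rightarrow> 'e)) set \<Rightarrow> (('v \<Rightarrow> 'v) \<times> ('e \<Rightarrow> 'e)) set" where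
  "plus_k T arev k G =
     generate (aut_group T arev) (\<Union>e \<in> arcs T. pointwise_stab (edge_nbhd T e (k - 1)) G)"


section \<open>Permutation groups and local actions\<close>

definition perm_isomorphic ::
  "'a set \<Rightarrow> ('a \<Rightarrow> 'a) set \<Rightarrow> 'b set \<Rightarrow> ('b \<Rightarrow> 'b) set \<Rightarrow> bool" where
  "perm_isomorphic X P Y Q \<longleftrightarrow>
     (\<exists>\<phi> \<psi>. bij_betw \<phi> X Y \<and>
        \<psi> \<in> iso (BijGroup X \<lparr>carrier := P\<rparr>) (BijGroup Y \<lparr>carrier := Q\<rparr>) \<and>
        (\<forall>p \<in> P. \<forall>x \<in> X. \<phi> (p x) = \<psi> p (\<phi> x)))"

definition local_action ::
  "('v, 'e) pre_digraph \<Rightarrow> (('v \<Rightarrow> 'v) \<times> ('e \<Rightarrow> 'e)) set \<Rightarrow> 'v \<Rightarrow> ('e \<Rightarrow> 'e) set" where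
  "local_action T H x = {restrict (snd h) (out_arcs T x) | h. h \<in> H \<and> fst h x = x}"

definition locally_perm_isomorphic :: "('v, 'e) pre_digraph \<Rightarrow>
  (('v \<Rightarrow> 'v) \<times> ('e \<Rightarrow> 'e)) set \<Rightarrow> 'a set \<Rightarrow> ('a \<Rightarrow> 'a) set \<Rightarrow> bool" where
  "locally_perm_isomorphic T H \<Omega> F \<longleftrightarrow>
     (\<forall>x \<in> verts T. perm_isomorphic (out_arcs T x) (local_action T H x) \<Omega> F)"

definition transitive_on :: "'a set \<Rightarrow> ('a \<Rightarrow> 'a) set \<Rightarrow> bool" where
  "transitive_on X P \<longleftrightarrow> (\<forall>x \<in> X. \<forall>y \<in> X. \<exists>p \<in> P. p x = y)"

definition point_stab :: "('a \<Rightarrow> 'a) set \<Rightarrow> 'a \<Rightarrow> ('a \<Rightarrow> 'a) set" where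
  "point_stab F \<omega> = {f \<in> F. f \<omega> = \<omega>}"

definition subnormal :: "'g set \<Rightarrow> ('g, 'm) monoid_scheme \<Rightarrow> bool" where
  "subnormal N G \<longleftrightarrow> (\<exists>n (S :: nat \<Rightarrow> 'g set). S 0 = carrier G \<and> S n = N \<and>
     (\<forall>i < n. S (Suc i) \<lhd> G \<lparr>carrier := S i\<rparr>))"

end

theory Submission
  imports Defs
begin

text \<open>Write \<open>G k\<close> for the closure of \<open>H\<close> of index \<open>k\<close> and \<open>A k\<close> for the subgroup of \<open>G k\<close> generated
  by the fixators of edge neighbourhoods of radius \<open>k - 1\<close>. Let \<open>k \<le> l\<close>, so that \<open>G l \<subseteq> G k\<close>. An
  isomorphism of topological groups between \<open>A k\<close> and \<open>A l\<close> forces \<open>G k = G l\<close>, in three steps.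

  Transitivity. Since \<open>H\<close> is not discrete, fixators of large balls are nontrivial. They act on the
  neighbours of suitable vertices as nontrivial subnormal subgroups of point stabilisers in \<open>F\<close>
  (\<open>fixator_transitive_on_forward\<close>), hence transitively on all but one of
  them. It follows that \<open>H\<close> is transitive on pairs of vertices at any given distance, and that in \<open>A k\<close>, which contains the
  fixators of large balls in \<open>H\<close>, the stabiliser of a vertex is transitive on each sphere around it
  (\<open>sphere_transitive_plus\<close>).

  Rigidity. Both groups preserve the bipartition of the tree. A continuous homomorphism maps a
  vertex stabiliser to a group with a finite orbit, which then fixes a vertex; applied to the
  isomorphism and its inverse, this shows that vertex stabilisers correspond. The sizes of the
  orbits of a stabiliser are those of spheres and so recover distances. Therefore the isomorphism
  is conjugation by an isometry of the vertex set (\<open>topological_isomorphism_induced\<close>).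

  Comparison. In \<open>G k\<close> and in \<open>G l\<close> the fixators of the neighbourhood of radius \<open>l - 1\<close> of an edge
  lie in \<open>A k\<close> and \<open>A l\<close>. The isometry, followed by an element of \<open>H\<close> that
  brings the edge back, conjugates one to the other, so they have equally many restrictions to any finite neighbourhood of the edge; being nested and closed, they are equal
  (\<open>conjugate_plus_imp_fixator_subset\<close>). Now independence enters: an element of \<open>G k\<close> that fixes the
  neighbourhood of radius \<open>k - 1\<close> of an edge is a product of elements supported on half-trees, and
  each of these fixes the neighbourhood of radius \<open>l - 1\<close> of an edge far away, so it lies in \<open>G l\<close>.
  This yields \<open>G k = G l\<close> (\<open>Pk_eqI\<close>).\<close>


section \<open>Distances in a tree\<close>

context regular_tree
begin

abbreviation V where "V \<equiv> verts T"
abbreviation D where "D \<equiv> vdist T"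

definition reduced :: "'e list \<Rightarrow> bool" where
  "reduced p \<longleftrightarrow> successively (\<lambda>e f. f \<noteq> arev e) p"

definition sphere :: "'v \<Rightarrow> nat \<Rightarrow> 'v set" where
  "sphere x n = {v \<in> V. D x v = n}"

definition ball :: "'v \<Rightarrow> nat \<Rightarrow> 'v set" where
  "ball x n = {v \<in> V. D x v \<le> n}"

lemma awalk_rev:
  assumes "awalk u p v"
  shows "awalk v (map arev (rev p)) u"
  using assms
proof (induction p arbitrary: u)
  case Nil
  then show ?case by (auto simp: awalk_Nil_iff)
next
  case (Cons e p)
  then have "e \<in> arcs T" "tail T e = u" "awalk v (map arev (rev p)) (head T e)"
    by (auto simp: awalk_Cons_iff)
  then show ?case by (auto simp: awalk_simps intro: awalk_last_in_verts)
qed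

lemma reduced_rev: "reduced (map arev (rev p)) \<longleftrightarrow> reduced p"
  by (auto simp: reduced_def successively_map successively_rev arev_eq_iff
      elim!: successively_mono)

text \<open>If a reduced closed walk visits no vertex twice, it is a circuit. Otherwise the part between two
  visits of a vertex is a shorter reduced closed walk.\<close>

lemma no_reduced_closed_walk:
  assumes "awalk u p u" "reduced p"
  shows "p = []"
  using assms
proof (induction "length p" arbitrary: u p rule: less_induct)
  case less
  show ?case
  proof (rule ccontr)
    assume ne: "p \<noteq> []"
    have cas: "cas u p u" using less.prems by (auto simp: awalk_def)
    show False
    proof (cases "distinct (map (head T) p)")
      case True
      then have "cycle p"
        unfolding cycle_def using less.prems(1) ne awalk_verts_conv'[OF cas] by auto
      with no_circuit[of p] obtain e where "p = [e, arev e]"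
        by (auto simp: circuit_def)
      with less.prems(2) show False by (simp add: reduced_def)
    next
      case False
      then obtain xs ys zs y where "map (head T) p = xs @ [y] @ ys @ [y] @ zs"
        using not_distinct_decomp by blast
      then obtain p1 e p2 f p3 where p: "p = p1 @ e # p2 @ f # p3" "head T e = y" "head T f = y"
        by (auto simp: map_eq_append_conv map_eq_Cons_conv Cons_eq_map_conv append_eq_map_conv)
      have "awalk y (p2 @ [f]) y"
        using less.prems(1) p by (auto simp: awalk_simps)
      moreover have "reduced (p2 @ [f])"
        using less.prems(2) p(1)
        by (auto simp: reduced_def successively_append_iff successively_Cons)
      ultimately have "p2 @ [f] = []"
        using less.hyps[of "p2 @ [f]" y] p(1) by simp
      then show False by simp
    qed
  qed
qed

text \<open>Two reduced walks with the same ends that differ in their last arc form a reduced closed walk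
  when the second one is run backwards.\<close>

lemma reduced_walk_unique:
  assumes "awalk u p v" "awalk u q v" "reduced p" "reduced q"
  shows "p = q"
  using assms
proof (induction p arbitrary: q v rule: rev_induct)
  case Nil
  then show ?case using no_reduced_closed_walk by (auto simp: awalk_Nil_iff)
next
  case (snoc e p)
  show ?case
  proof (cases q rule: rev_cases)
    case Nil
    then have "u = v" using snoc.prems by (simp add: awalk_Nil_iff)
    then show ?thesis using no_reduced_closed_walk snoc.prems by blast
  next
    case q: (snoc q' f)
    have w: "awalk u p (tail T e)" "awalk u q' (tail T f)" "head T e = v" "head T f = v"
      using snoc.prems q by (auto simp: awalk_simps)
    have r: "reduced p" "reduced q'"
      using snoc.prems q by (auto simp: reduced_def successively_append_iff)
    show ?thesis
    proof (cases "e = f")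
      case True
      then show ?thesis using snoc.IH w r q by auto
    next
      case False
      have "awalk u ((p @ [e]) @ map arev (rev q)) u"
        using snoc.prems awalk_rev[of u q v] by (auto simp del: append_assoc)
      moreover have "reduced ((p @ [e]) @ map arev (rev q))"
        using snoc.prems reduced_rev[of q] False q
        by (auto simp: reduced_def successively_append_iff arev_eq_iff)
      ultimately have "(p @ [e]) @ map arev (rev q) = []"
        using no_reduced_closed_walk by blast
      then show ?thesis by simp
    qed
  qed
qed

text \<open>Cancelling backtracks only shortens a walk. Hence the unique reduced walk between two vertices
  is the shortest one, and its length is their distance.\<close>

lemma reduced_walk_exists:
  assumes "awalk u p v"
  shows "\<exists>q. awalk u q v \<and> reduced q \<and> length q \<le> length p"
  using assms
proof (induction p arbitrary: u)
  case Nil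
  then show ?case by (intro exI[of _ "[]"]) (auto simp: reduced_def)
next
  case (Cons e p)
  then have e: "e \<in> arcs T" "tail T e = u" and "awalk (head T e) p v"
    by (auto simp: awalk_Cons_iff)
  with Cons.IH obtain q where q: "awalk (head T e) q v" "reduced q" "length q \<le> length p"
    by blast
  show ?case
  proof (cases "\<exists>q'. q = arev e # q'")
    case True
    then obtain q' where "q = arev e # q'" by blast
    with q e show ?thesis
      by (intro exI[of _ q']) (auto simp: awalk_simps reduced_def successively_Cons)
  next
    case False
    with q e show ?thesis
      by (intro exI[of _ "e # q"], cases q) (auto simp: awalk_simps reduced_def successively_Cons)
  qed
qed

lemma D_le: "awalk u p v \<Longrightarrow> D u v \<le> length p"
  unfolding vdist_def by (rule Least_le) blast

lemma D_reduced:
  assumes "awalk u p v" "reduced p"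
  shows "D u v = length p"
proof (rule antisym[OF D_le[OF assms(1)]])
  have "\<exists>n p. awalk u p v \<and> length p = n" using assms by blast
  then have "\<exists>p. awalk u p v \<and> length p = D u v"
    unfolding vdist_def by (rule LeastI_ex)
  then obtain g where "awalk u g v" "length g = D u v" by blast
  with reduced_walk_exists[of u g v] reduced_walk_unique[OF assms(1) _ assms(2)]
  show "length p \<le> D u v" by force
qed

lemma geodesic:
  assumes "u \<in> V" "v \<in> V"
  obtains p where "awalk u p v" "reduced p" "length p = D u v"
proof -
  have "u \<rightarrow>\<^sup>*\<^bsub>T\<^esub> v" using connected_tree assms by auto
  then obtain p where "awalk u p v" by (auto simp: reachable_awalk)
  with reduced_walk_exists D_reduced that show ?thesis by metis
qed

lemma D_self [simp]: "u \<in> V \<Longrightarrow> D u u = 0"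
  using D_le[of u "[]" u] by (simp add: awalk_Nil_iff)

lemma D_eq_0: "u \<in> V \<Longrightarrow> v \<in> V \<Longrightarrow> D u v = 0 \<longleftrightarrow> u = v"
  by (metis D_self awalk_Nil_iff geodesic length_0_conv)

lemma D_commute: "u \<in> V \<Longrightarrow> v \<in> V \<Longrightarrow> D u v = D v u"
  by (metis D_reduced awalk_rev geodesic length_map length_rev reduced_rev)

lemma D_triangle:
  assumes "u \<in> V" "v \<in> V" "w \<in> V"
  shows "D u w \<le> D u v + D v w"
proof -
  obtain p where "awalk u p v" "length p = D u v" using assms geodesic by blast
  moreover obtain q where "awalk v q w" "length q = D v w" using assms geodesic by blast
  ultimately show ?thesis using D_le[of u "p @ q" w] by auto
qed

lemma D_arc: "e \<in> arcs T \<Longrightarrow> D (tail T e) (head T e) = 1"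
  using D_reduced[of "tail T e" "[e]" "head T e"] by (simp add: arc_implies_awalk reduced_def)

lemma arc_unique:
  assumes "e \<in> arcs T" "f \<in> arcs T" "tail T e = tail T f" "head T e = head T f"
  shows "e = f"
  using reduced_walk_unique[of "tail T e" "[e]" "head T e" "[f]"] assms
  by (simp add: awalk_simps reduced_def)

lemma D_1_arc:
  assumes "u \<in> V" "v \<in> V" "D u v = 1"
  obtains e where "e \<in> arcs T" "tail T e = u" "head T e = v"
proof -
  obtain p where p: "awalk u p v" "length p = 1" using assms geodesic by metis
  then obtain e where "p = [e]" by (auto simp: length_Suc_conv)
  with p that show ?thesis by (auto simp: awalk_simps)
qed

lemma pred_exists:
  assumes "u \<in> V" "v \<in> V" "D u v = Suc n"
  obtains w where "w \<in> V" "D u w = n" "D w v = 1"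
proof -
  obtain p where p: "awalk u p v" "reduced p" "length p = Suc n" using assms geodesic by metis
  then obtain q e where q: "p = q @ [e]" by (metis length_Suc_conv_rev)
  with p have e: "e \<in> arcs T" "head T e = v" "awalk u q (tail T e)" "reduced q"
    by (auto simp: awalk_simps reduced_def successively_append_iff)
  then have "D u (tail T e) = n" using D_reduced[of u q "tail T e"] q p by simp
  then show ?thesis using that[of "tail T e"] e D_arc by auto
qed

text \<open>The reduced walk from \<open>u\<close> to \<open>w\<close> either prolongs the one
  to \<open>v\<close> by the edge from \<open>v\<close> to \<open>w\<close>, or is obtained from it by deleting that edge.\<close>

lemma D_adjacent:
  assumes "u \<in> V" "v \<in> V" "w \<in> V" "D v w = 1"
  shows "D u w = Suc (D u v) \<or> D u v = Suc (D u w)"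
proof -
  obtain e where e: "e \<in> arcs T" "tail T e = v" "head T e = w" using assms D_1_arc by blast
  obtain p where p: "awalk u p v" "reduced p" "length p = D u v" using assms geodesic by metis
  show ?thesis
  proof (cases "p \<noteq> [] \<and> last p = arev e")
    case True
    then obtain q where q: "p = q @ [arev e]" by (metis append_butlast_last_id)
    with p e have "awalk u q w" "reduced q"
      by (auto simp: awalk_simps reduced_def successively_append_iff)
    then show ?thesis using D_reduced[of u q w] p q by simp
  next
    case False
    with p e have "awalk u (p @ [e]) w" "reduced (p @ [e])"
      by (auto simp: awalk_simps reduced_def successively_append_iff)
    then show ?thesis using D_reduced[of u "p @ [e]" w] p by simp
  qed
qed

lemma pred_unique:
  assumes V: "u \<in> V" "v \<in> V" "w \<in> V" "w' \<in> V"
    and D: "D u v = Suc n" "D u w = n" "D u w' = n" "D w v = 1" "D w' v = 1"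
  shows "w = w'"
proof -
  have *: "\<exists>p e. awalk u (p @ [e]) v \<and> reduced (p @ [e]) \<and> tail T e = x"
    if x: "x \<in> V" "D u x = n" "D x v = 1" for x
  proof -
    obtain e where e: "e \<in> arcs T" "tail T e = x" "head T e = v" using V x D_1_arc by blast
    obtain p where p: "awalk u p x" "reduced p" "length p = n" using V x geodesic by metis
    have w: "awalk u (p @ [e]) v" using p e by (auto simp: awalk_simps)
    from reduced_walk_exists[OF w] obtain q where q: "awalk u q v" "reduced q" by blast
    have "reduced (p @ [e])"
    proof (rule ccontr)
      assume "\<not> reduced (p @ [e])"
      with p have "p \<noteq> [] \<and> e = arev (last p)"
        by (auto simp: reduced_def successively_append_iff)
      then obtain r where "p = r @ [arev e]" by (metis append_butlast_last_id arev_arev)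
      with p e have "awalk u r v" "length r < n" by (auto simp: awalk_simps)
      then show False using D_le D(1) by fastforce
    qed
    then show ?thesis using w e by blast
  qed
  obtain p e where 1: "awalk u (p @ [e]) v" "reduced (p @ [e])" "tail T e = w" using * V D by metis
  obtain q f where 2: "awalk u (q @ [f]) v" "reduced (q @ [f])" "tail T f = w'" using * V D by metis
  from reduced_walk_unique[OF 1(1) 2(1) 1(2) 2(2)] 1(3) 2(3) show ?thesis by simp
qed

lemma sphere_1_head:
  assumes "x \<in> V"
  shows "bij_betw (head T) (out_arcs T x) (sphere x 1)"
proof (rule bij_betw_imageI)
  show "inj_on (head T) (out_arcs T x)" by (auto simp: inj_on_def intro: arc_unique)
  show "head T ` out_arcs T x = sphere x 1"
  proof
    show "head T ` out_arcs T x \<subseteq> sphere x 1" using D_arc by (auto simp: sphere_def)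
    show "sphere x 1 \<subseteq> head T ` out_arcs T x"
    proof
      fix w assume "w \<in> sphere x 1"
      then obtain e where "e \<in> arcs T" "tail T e = x" "head T e = w"
        using assms D_1_arc by (auto simp: sphere_def)
      then show "w \<in> head T ` out_arcs T x" by auto
    qed
  qed
qed

lemma sphere_1: "x \<in> V \<Longrightarrow> finite (sphere x 1) \<and> card (sphere x 1) = d"
  using sphere_1_head regular bij_betw_finite bij_betw_same_card by metis

lemma vertex_exists: "V \<noteq> {}"
  using connected_tree by (simp add: strongly_connected_def)

lemma ball_V: "ball x n \<subseteq> V"
  and sphere_V: "sphere x n \<subseteq> V"
  by (auto simp: ball_def sphere_def)

lemma sphere_0: "x \<in> V \<Longrightarrow> sphere x 0 = {x}"
  by (auto simp: sphere_def D_eq_0)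

lemma ball_0: "x \<in> V \<Longrightarrow> ball x 0 = {x}"
  by (auto simp: ball_def D_eq_0)

lemma ball_Suc: "ball x (Suc n) = ball x n \<union> sphere x (Suc n)"
  by (auto simp: ball_def sphere_def)

text \<open>The neighbours of \<open>y\<close> that prolong the geodesic from \<open>x\<close> to \<open>y\<close>; for \<open>x = y\<close> these are all
  neighbours.\<close>

definition forward :: "'v \<Rightarrow> 'v \<Rightarrow> 'v set" where
  "forward x y = {w \<in> V. D y w = 1 \<and> D x w = Suc (D x y)}"

lemma forward_sphere: "forward x y \<subseteq> sphere y 1"
  by (auto simp: forward_def sphere_def)

lemma forward_eq:
  assumes "x \<in> V" "y \<in> V" "w \<in> V" "D y w = 1" "D x y = Suc (D x w)"
  shows "forward x y = sphere y 1 - {w}"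
proof -
  have "u = w" if "u \<in> sphere y 1" "u \<notin> forward x y" for u
  proof -
    have u: "u \<in> V" "D y u = 1" "D x u \<noteq> Suc (D x y)" using that by (auto simp: forward_def sphere_def)
    with D_adjacent[of x y u] assms have "D x y = Suc (D x u)" by auto
    with u assms show ?thesis using pred_unique[of x y u w "D x w"] D_commute by auto
  qed
  moreover have "w \<notin> forward x y" using assms by (auto simp: forward_def)
  ultimately show ?thesis using forward_sphere by auto
qed

lemma forward_self: "x \<in> V \<Longrightarrow> forward x x = sphere x 1"
  by (auto simp: forward_def sphere_def)

lemma card_forward:
  assumes "x \<in> V" "y \<in> V" "x \<noteq> y"
  shows "card (forward x y) = d - 1" "finite (forward x y)"
proof -
  obtain n where n: "D x y = Suc n" using assms D_eq_0 by (metis not0_implies_Suc)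
  then obtain w where w: "w \<in> V" "D x w = n" "D w y = 1" using assms pred_exists by metis
  then have "forward x y = sphere y 1 - {w}" "w \<in> sphere y 1"
    using assms n forward_eq[of x y w] D_commute by (auto simp: sphere_def)
  then show "card (forward x y) = d - 1" "finite (forward x y)" using sphere_1[of y] assms by auto
qed

lemma sphere_Suc:
  assumes "x \<in> V"
  shows "sphere x (Suc n) = (\<Union>y\<in>sphere x n. forward x y)"
proof
  show "sphere x (Suc n) \<subseteq> (\<Union>y\<in>sphere x n. forward x y)"
  proof
    fix w assume "w \<in> sphere x (Suc n)"
    then have w: "w \<in> V" "D x w = Suc n" by (auto simp: sphere_def)
    then obtain y where "y \<in> V" "D x y = n" "D y w = 1" using assms pred_exists by metis
    with w show "w \<in> (\<Union>y\<in>sphere x n. forward x y)" by (auto simp: sphere_def forward_def)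
  qed
qed (auto simp: sphere_def forward_def)

lemma card_sphere:
  assumes "x \<in> V"
  shows "finite (sphere x (Suc n)) \<and> card (sphere x (Suc n)) = d * (d - 1) ^ n"
proof (induction n)
  case 0
  then show ?case using sphere_1 assms by simp
next
  case (Suc n)
  let ?S = "sphere x (Suc n)"
  have ne: "y \<in> V" "x \<noteq> y" if "y \<in> ?S" for y using that assms by (auto simp: sphere_def)
  have "card (\<Union>y\<in>?S. forward x y) = (\<Sum>y\<in>?S. card (forward x y))"
  proof (rule card_UN_disjoint)
    show "\<forall>y\<in>?S. \<forall>z\<in>?S. y \<noteq> z \<longrightarrow> forward x y \<inter> forward x z = {}"
    proof (intro ballI impI equals0I)
      fix y z w assume "y \<in> ?S" "z \<in> ?S" "y \<noteq> z" "w \<in> forward x y \<inter> forward x z"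
      then show False
        using pred_unique[of x w y z "Suc n"] assms by (auto simp: forward_def sphere_def)
    qed
  qed (use Suc card_forward assms ne in auto)
  also have "\<dots> = (\<Sum>y\<in>?S. d - 1)"
    using card_forward assms ne by (intro sum.cong) auto
  finally show ?case
    using Suc card_forward assms ne sphere_Suc[OF assms, of "Suc n"] by auto
qed

lemma finite_sphere: "x \<in> V \<Longrightarrow> finite (sphere x n)"
  using card_sphere sphere_0 by (cases n) auto

lemma finite_ball: "x \<in> V \<Longrightarrow> finite (ball x n)"
  by (induction n) (auto simp: ball_0 ball_Suc finite_sphere)

lemma geodesic_point:
  assumes "x \<in> V" "y \<in> V" "D x y = m" "n \<le> m"
  obtains z where "z \<in> V" "D x z = m - n" "D z y = n"
proof -
  have "\<exists>z\<in>V. D x z = m - n \<and> D z y = n"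
    using assms(4)
  proof (induction n)
    case 0
    then show ?case using assms by auto
  next
    case (Suc n)
    then obtain z where z: "z \<in> V" "D x z = Suc (m - Suc n)" "D z y = n"
      by (metis Suc_diff_Suc Suc_leD Suc_le_lessD)
    then obtain w where w: "w \<in> V" "D x w = m - Suc n" "D w z = 1"
      using assms pred_exists by metis
    have "D x y \<le> D x w + D w y" "D w y \<le> D w z + D z y"
      using D_triangle assms(1,2) z(1) w(1) by blast+
    then have "D w y = Suc n" using assms z w Suc.prems by simp
    then show ?case using w by auto
  qed
  then show ?thesis using that by blast
qed

text \<open>Removing the edge between \<open>x\<close> and \<open>y\<close> disconnects the tree into the vertices closer to \<open>x\<close>
  and those closer to \<open>y\<close>, so a geodesic between the two sides crosses this edge. The induction
  moves \<open>z\<close> away from \<open>y\<close>: the distance to \<open>v\<close> cannot start to decrease, since the vertex before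
  \<open>z\<close> would then have two neighbours that are closer to \<open>v\<close>.\<close>

lemma bridge:
  assumes V: "x \<in> V" "y \<in> V" "v \<in> V" "z \<in> V"
    and "D x y = 1" "D v y = Suc (D v x)" "D z x = Suc (D z y)"
  shows "D v z = D v x + 1 + D z y"
  using assms
proof (induction "D z y" arbitrary: z rule: less_induct)
  case less
  show ?case
  proof (cases "D z y")
    case 0
    then show ?thesis using less.prems D_eq_0 by auto
  next
    case (Suc n)
    obtain z' where z': "z' \<in> V" "D y z' = n" "D z' z = 1"
      using Suc less.prems pred_exists[of y z n] D_commute by metis
    have zy: "D z' y = n" using z' D_commute less.prems by auto
    have zx: "D z' x = Suc n"
    proof -
      have "D z z' = 1" "D y x = 1" using z' less.prems D_commute by metis+
      then show ?thesis
        using Suc D_triangle[of z z' x] D_triangle[of z' y x] z' zy less.prems by simp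
    qed
    have IH: "D v z' = D v x + 1 + n"
      using less.hyps[of z'] z' zy zx Suc less.prems by auto
    have "D v z' \<noteq> Suc (D v z)"
    proof
      assume *: "D v z' = Suc (D v z)"
      show False
      proof (cases n)
        case 0
        then have "z' = y" using zy z'(1) less.prems(2) D_eq_0 by simp
        moreover have "D z y = 1" using Suc 0 by simp
        moreover have "D v y = Suc (D v x)" "D v z = D v x" using less.prems * IH 0 by simp_all
        ultimately have "z = x"
          using less.prems(1-5) pred_unique[of v y z x "D v x"] by blast
        then show False using less.prems by auto
      next
        case (Suc k)
        obtain w where w: "w \<in> V" "D y w = k" "D w z' = 1"
          using Suc z' less.prems pred_exists by metis
        have wy: "D w y = k" using w D_commute less.prems by auto
        have wx: "D w x = Suc k"
        proof -
          have "D z' w = 1" "D y x = 1" using w z' less.prems D_commute by metis+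
          then show ?thesis
            using Suc D_triangle[of z' w x] D_triangle[of w y x] w z' zx wy less.prems by simp
        qed
        have "D v w = D v x + 1 + k"
          using less.hyps[of w] w wy wx Suc \<open>D z y = Suc n\<close> less.prems by auto
        moreover have "D z z' = 1" using z' less.prems D_commute by metis
        moreover have "D v w = D v z" using * IH Suc \<open>D v w = D v x + 1 + k\<close> by simp
        ultimately have "w = z"
          using * w(1,3) z'(1) less.prems(3,4) pred_unique[of v z' w z "D v z"] by blast
        then show False using wy \<open>D z y = Suc n\<close> Suc by auto
      qed
    qed
    then show ?thesis using D_adjacent[of v z' z] IH Suc z' less.prems by auto
  qed
qed

text \<open>The only edge between the two sides is the separating edge itself: by the bridge formula
  endpoints of any other edge between them would have distance greater than one.\<close>

lemma half_tree_boundary: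
  assumes "x \<in> V" "y \<in> V" "v \<in> V" "w \<in> V" "D x y = 1" "D v w = 1"
    and "D v x < D v y" "\<not> D w x < D w y"
  shows "v = x \<and> w = y"
proof -
  have "D v y = Suc (D v x)" "D w x = Suc (D w y)"
    using D_adjacent[of v x y] D_adjacent[of w x y] assms by auto
  with bridge[of x y v w] assms show ?thesis using D_eq_0 by auto
qed

text \<open>Along a geodesic from \<open>v\<close> to \<open>w\<close> the distance to \<open>z\<close> changes by one at each step and, once it
  has increased, never decreases again. So an interior vertex is closer to \<open>z\<close> than the farther
  endpoint, and the same interior vertex serves for all \<open>z\<close>.\<close>

lemma interior_point:
  assumes "v \<in> V" "w \<in> V" "D v w \<ge> 2"
  obtains u where "u \<in> V" "\<And>z. z \<in> V \<Longrightarrow> D z u < max (D z v) (D z w)"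
proof -
  obtain n where n: "D v w = Suc n" "n \<ge> 1" using assms by (cases "D v w") auto
  then obtain u where u: "u \<in> V" "D w u = n" "D u v = 1"
    using assms pred_exists[of w v n] D_commute by metis
  have "D z u < max (D z v) (D z w)" if z: "z \<in> V" for z
  proof (cases "D z v = Suc (D z u)")
    case False
    have *: "D v u = 1" "D w v = Suc (D w u)" using u n assms D_commute by metis+
    with False have "D z u = Suc (D z v)" using D_adjacent[of z v u] u z assms by simp
    then have "D z w = D z v + 1 + D w u"
      using bridge[of v u z w] * u z assms by simp
    then show ?thesis using n u \<open>D z u = Suc (D z v)\<close> by auto
  qed auto
  with u that show ?thesis by blast
qed

text \<open>A tree is bipartite.\<close>

lemma even_D_triangle:
  assumes "u \<in> V" "v \<in> V" "w \<in> V"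
  shows "even (D u v + D v w + D u w)"
  using assms
proof (induction "D v w" arbitrary: w)
  case 0
  then show ?case using D_eq_0 by auto
next
  case (Suc n)
  then obtain z where z: "z \<in> V" "D v z = n" "D z w = 1" using pred_exists by metis
  then have "even (D u v + n + D u z)" using Suc.hyps(1)[of z] Suc.prems by simp
  moreover have "D u w = Suc (D u z) \<or> D u z = Suc (D u w)"
    using z Suc.prems D_adjacent[of u z w] by simp
  ultimately show ?case using Suc.hyps(2)[symmetric] by auto
qed

end


section \<open>Automorphisms as isometries\<close>

lemma Bij_if:
  assumes "g \<in> Bij X" "Y \<subseteq> X" "g ` Y = Y"
  shows "(\<lambda>x \<in> X. if x \<in> Y then g x else x) \<in> Bij X"
proof -
  have "inj_on g Y"
    using assms(1,2) by (auto simp: Bij_def bij_betw_def intro: inj_on_subset)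
  then have "bij_betw g Y Y" using assms(3) by (simp add: bij_betw_def)
  then have "bij_betw (\<lambda>x. if x \<in> Y then g x else x) (Y \<union> (X - Y)) (Y \<union> (X - Y))"
    by (intro bij_betw_disjoint_Un) (auto simp: bij_betw_def inj_on_def)
  then have "bij_betw (\<lambda>x. if x \<in> Y then g x else x) X X"
    using assms(2) by (simp add: Un_absorb1)
  then show ?thesis by (simp add: Bij_def)
qed

context regular_tree
begin

abbreviation Aut where "Aut \<equiv> aut_group T arev"

lemma group_Aut: "group Aut"
  by (rule group_aut_group[OF bidirected_digraph_axioms])

lemma carrier_Aut [simp]: "carrier Aut = aut T arev"
  by (simp add: aut_group_def)

lemma subgroup_aut: "subgroup G Aut \<Longrightarrow> G \<subseteq> aut T arev"
  using subgroup.subset[of G Aut] by simp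

lemma aut_Bij:
  assumes "g \<in> aut T arev"
  shows "fst g \<in> Bij V" "snd g \<in> Bij (arcs T)"
  using assms by (auto simp: aut_def)

lemma aut_V [simp]: "g \<in> aut T arev \<Longrightarrow> v \<in> V \<Longrightarrow> fst g v \<in> V"
  using aut_Bij(1) Bij_imp_funcset by fastforce

lemma aut_arcs [simp]: "g \<in> aut T arev \<Longrightarrow> e \<in> arcs T \<Longrightarrow> snd g e \<in> arcs T"
  using aut_Bij(2) Bij_imp_funcset by fastforce

lemma aut_ends:
  assumes "g \<in> aut T arev" "e \<in> arcs T"
  shows "tail T (snd g e) = fst g (tail T e)" "head T (snd g e) = fst g (head T e)"
  using assms by (auto simp: aut_def)

lemma aut_arev: "g \<in> aut T arev \<Longrightarrow> e \<in> arcs T \<Longrightarrow> snd g (arev e) = arev (snd g e)"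
  by (auto simp: aut_def)

lemma aut_inj: "g \<in> aut T arev \<Longrightarrow> u \<in> V \<Longrightarrow> v \<in> V \<Longrightarrow> fst g u = fst g v \<longleftrightarrow> u = v"
  using aut_Bij(1)[of g] by (auto simp: Bij_def bij_betw_def dest: inj_onD)

lemma aut_mult [simp]:
  assumes "g \<in> aut T arev" "h \<in> aut T arev"
  shows "v \<in> V \<Longrightarrow> fst (g \<otimes>\<^bsub>Aut\<^esub> h) v = fst g (fst h v)"
    and "e \<in> arcs T \<Longrightarrow> snd (g \<otimes>\<^bsub>Aut\<^esub> h) e = snd g (snd h e)"
  using aut_Bij[OF assms(1)] aut_Bij[OF assms(2)]
  by (cases g; cases h; simp add: aut_group_def BijGroup_def compose_eq)+

lemma aut_one [simp]: "v \<in> V \<Longrightarrow> fst \<one>\<^bsub>Aut\<^esub> v = v" "e \<in> arcs T \<Longrightarrow> snd \<one>\<^bsub>Aut\<^esub> e = e"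
  by (simp_all add: aut_group_def BijGroup_def DirProd_def)

lemma aut_closed [simp]:
  assumes "g \<in> aut T arev"
  shows "h \<in> aut T arev \<Longrightarrow> g \<otimes>\<^bsub>Aut\<^esub> h \<in> aut T arev" "inv\<^bsub>Aut\<^esub> g \<in> aut T arev"
  using assms group.inv_closed[OF group_Aut, of g] monoid.m_closed[OF group.axioms(1)[OF group_Aut]]
  by auto

lemma aut_inv [simp]:
  assumes "g \<in> aut T arev" "v \<in> V"
  shows "fst (inv\<^bsub>Aut\<^esub> g) (fst g v) = v" "fst g (fst (inv\<^bsub>Aut\<^esub> g) v) = v"
proof -
  interpret group Aut by (rule group_Aut)
  have "inv\<^bsub>Aut\<^esub> g \<otimes>\<^bsub>Aut\<^esub> g = \<one>\<^bsub>Aut\<^esub>" "g \<otimes>\<^bsub>Aut\<^esub> inv\<^bsub>Aut\<^esub> g = \<one>\<^bsub>Aut\<^esub>" using assms by auto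
  then show "fst (inv\<^bsub>Aut\<^esub> g) (fst g v) = v" "fst g (fst (inv\<^bsub>Aut\<^esub> g) v) = v"
    using assms aut_mult(1) aut_one(1) aut_closed by metis+
qed

lemma aut_inv_eq:
  "g \<in> aut T arev \<Longrightarrow> u \<in> V \<Longrightarrow> v \<in> V \<Longrightarrow> fst (inv\<^bsub>Aut\<^esub> g) v = u \<longleftrightarrow> fst g u = v"
  by (metis aut_inv)

lemma aut_D_le:
  assumes "g \<in> aut T arev" "u \<in> V" "v \<in> V"
  shows "D (fst g u) (fst g v) \<le> D u v"
proof -
  obtain p where p: "awalk u p v" "length p = D u v" using assms geodesic by metis
  have "awalk (fst g u) (map (snd g) p) (fst g v)" using p(1)
  proof (induction p arbitrary: u)
    case Nil
    then show ?case using assms by (auto simp: awalk_simps)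
  next
    case (Cons e p)
    then show ?case using assms by (auto simp: awalk_simps aut_ends)
  qed
  then show ?thesis using D_le p(2) by force
qed

lemma aut_D [simp]:
  assumes "g \<in> aut T arev" "u \<in> V" "v \<in> V"
  shows "D (fst g u) (fst g v) = D u v"
  using aut_D_le[OF assms] aut_D_le[of "inv\<^bsub>Aut\<^esub> g" "fst g u" "fst g v"] assms by simp

lemma aut_arc_eq:
  assumes "g \<in> aut T arev" "h \<in> aut T arev" "e \<in> arcs T"
    and "fst g (tail T e) = fst h (tail T e)" "fst g (head T e) = fst h (head T e)"
  shows "snd g e = snd h e"
  using assms by (intro arc_unique) (auto simp: aut_ends)

lemma aut_eqI:
  assumes "g \<in> aut T arev" "h \<in> aut T arev" "\<And>v. v \<in> V \<Longrightarrow> fst g v = fst h v"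
  shows "g = h"
proof (rule prod_eqI)
  have "fst g \<in> extensional V" "fst h \<in> extensional V"
    "snd g \<in> extensional (arcs T)" "snd h \<in> extensional (arcs T)"
    using aut_Bij assms(1,2) Bij_imp_extensional by blast+
  note ext = this
  show "fst g = fst h" by (rule extensionalityI[OF ext(1,2)]) (rule assms(3))
  show "snd g = snd h"
    by (rule extensionalityI[OF ext(3,4)]) (rule aut_arc_eq; use assms in simp)
qed

definition fixator :: "'v set \<Rightarrow> (('v \<Rightarrow> 'v) \<times> ('e \<Rightarrow> 'e)) set \<Rightarrow> (('v \<Rightarrow> 'v) \<times> ('e \<Rightarrow> 'e)) set"
  where "fixator X G = {g \<in> G. \<forall>v \<in> X. fst g v = v}"

definition nbhd :: "'e \<Rightarrow> nat \<Rightarrow> 'v set" where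
  "nbhd e n = ball (tail T e) n \<union> ball (head T e) n"

lemma nbhd_V: "nbhd e n \<subseteq> V"
  using ball_V by (auto simp: nbhd_def)

lemma finite_nbhd: "e \<in> arcs T \<Longrightarrow> finite (nbhd e n)"
  by (simp add: nbhd_def finite_ball)

lemma nbhd_mono: "m \<le> n \<Longrightarrow> nbhd e m \<subseteq> nbhd e n"
  by (auto simp: nbhd_def ball_def)

lemma nbhd_ends: "e \<in> arcs T \<Longrightarrow> tail T e \<in> nbhd e n \<and> head T e \<in> nbhd e n"
  by (simp add: nbhd_def ball_def)

lemma nbhd_arev: "e \<in> arcs T \<Longrightarrow> nbhd (arev e) n = nbhd e n"
  by (auto simp: nbhd_def)

lemma nbhd_subset_ball:
  assumes "e \<in> arcs T"
  shows "nbhd e n \<subseteq> ball (tail T e) (Suc n)"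
proof
  fix v assume v: "v \<in> nbhd e n"
  then have "v \<in> V" using nbhd_V by auto
  then have "D (tail T e) v \<le> 1 + D (head T e) v"
    using D_triangle[of "tail T e" "head T e" v] D_arc assms by simp
  with v show "v \<in> ball (tail T e) (Suc n)" by (auto simp: nbhd_def ball_def)
qed

lemma ball_subset_nbhd:
  assumes "e \<in> arcs T" "x \<in> V"
  shows "ball x n \<subseteq> nbhd e (D (tail T e) x + n)"
proof
  fix v assume v: "v \<in> ball x n"
  then show "v \<in> nbhd e (D (tail T e) x + n)"
    using D_triangle[of "tail T e" x v] assms by (auto simp: nbhd_def ball_def)
qed

lemma pointwise_stab_nbhd:
  assumes "G \<subseteq> aut T arev" "e \<in> arcs T"
  shows "pointwise_stab (edge_nbhd T e n) G = fixator (nbhd e n) G"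
proof -
  have "snd g f = f"
    if "g \<in> G" "\<forall>v \<in> nbhd e n. fst g v = v" "f \<in> arcs T" "tail T f \<in> nbhd e n" "head T f \<in> nbhd e n"
    for g f
    using aut_arc_eq[of g "\<one>\<^bsub>Aut\<^esub>" f] that assms group.is_monoid[OF group_Aut] monoid.one_closed
    by fastforce
  moreover have "{v \<in> V. D (tail T e) v \<le> n \<or> D (head T e) v \<le> n} = nbhd e n"
    by (auto simp: nbhd_def ball_def)
  ultimately show ?thesis
    unfolding pointwise_stab_def fixator_def edge_nbhd_def by auto
qed

lemma agree_on_ball:
  assumes "g \<in> aut T arev" "h \<in> aut T arev"
  shows "agree_on (ball_graph T x k) g h \<longleftrightarrow> (\<forall>v \<in> ball x k. fst g v = fst h v)"
proof -
  have "{v \<in> V. D x v \<le> k} = ball x k" by (auto simp: ball_def)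
  then show ?thesis
    using aut_arc_eq[OF assms] unfolding agree_on_def ball_graph_def by auto
qed

lemma fixator_conj:
  assumes "subgroup G Aut" "g \<in> G" "h \<in> fixator X G" "X \<subseteq> V"
  shows "g \<otimes>\<^bsub>Aut\<^esub> h \<otimes>\<^bsub>Aut\<^esub> inv\<^bsub>Aut\<^esub> g \<in> fixator (fst g ` X) G"
proof -
  have "g \<in> aut T arev" "h \<in> aut T arev" "h \<in> G"
    using assms subgroup_aut by (auto simp: fixator_def)
  with assms show ?thesis
    by (auto simp: fixator_def subset_iff intro!: subgroup.m_closed subgroup.m_inv_closed)
qed

lemma fixator_subgroup:
  assumes "subgroup G Aut" "X \<subseteq> V"
  shows "subgroup (fixator X G) Aut"
proof (rule group.subgroupI[OF group_Aut])
  have G: "G \<subseteq> aut T arev" using assms subgroup_aut by auto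
  then show "fixator X G \<subseteq> carrier Aut" by (auto simp: fixator_def)
  have "\<one>\<^bsub>Aut\<^esub> \<in> fixator X G" using assms by (auto simp: fixator_def subgroup.one_closed)
  then show "fixator X G \<noteq> {}" by auto
  show "inv\<^bsub>Aut\<^esub> g \<in> fixator X G" if "g \<in> fixator X G" for g
  proof -
    have "g \<in> G" "g \<in> aut T arev" using that G by (auto simp: fixator_def)
    then show ?thesis
      using that assms subgroup.m_inv_closed[OF assms(1)]
      by (auto simp: fixator_def subset_iff aut_inv_eq)
  qed
  show "g \<otimes>\<^bsub>Aut\<^esub> h \<in> fixator X G" if "g \<in> fixator X G" "h \<in> fixator X G" for g h
  proof -
    have "g \<in> G" "g \<in> aut T arev" "h \<in> G" "h \<in> aut T arev"
      using that G by (auto simp: fixator_def)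
    then show ?thesis
      using that assms subgroup.m_closed[OF assms(1)] by (auto simp: fixator_def subset_iff)
  qed
qed

section \<open>The closures and their independence property\<close>

abbreviation Pk where "Pk \<equiv> Pk_closure T arev"

lemma Pk_iff:
  assumes "H \<subseteq> aut T arev"
  shows "g \<in> Pk k H \<longleftrightarrow>
    g \<in> aut T arev \<and> (\<forall>x \<in> V. \<exists>h \<in> H. \<forall>v \<in> ball x k. fst g v = fst h v)"
  using assms agree_on_ball unfolding Pk_closure_def by blast

lemma Pk_aut: "Pk k H \<subseteq> aut T arev"
  by (auto simp: Pk_closure_def)

lemma Pk_superset:
  assumes "H \<subseteq> aut T arev"
  shows "H \<subseteq> Pk k H"
proof
  fix g assume "g \<in> H"
  with assms show "g \<in> Pk k H" unfolding Pk_iff[OF assms] by blast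
qed

lemma Pk_antimono:
  assumes "H \<subseteq> aut T arev" "k \<le> l"
  shows "Pk l H \<subseteq> Pk k H"
proof -
  have *: "ball x k \<subseteq> ball x l" for x using assms by (auto simp: ball_def)
  show ?thesis
  proof
    fix g assume g: "g \<in> Pk l H"
    have "\<exists>h \<in> H. \<forall>v \<in> ball x k. fst g v = fst h v" if "x \<in> V" for x
      using g that *[of x] unfolding Pk_iff[OF assms(1)] by blast
    with g show "g \<in> Pk k H" unfolding Pk_iff[OF assms(1)] by blast
  qed
qed

lemma Pk_closed:
  assumes "H \<subseteq> aut T arev" "g \<in> aut T arev"
    and *: "\<And>x. x \<in> V \<Longrightarrow> \<exists>h \<in> Pk k H. \<forall>v \<in> ball x k. fst g v = fst h v"
  shows "g \<in> Pk k H"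
  unfolding Pk_iff[OF assms(1)]
proof (intro conjI ballI)
  fix x assume x: "x \<in> V"
  then obtain h where h: "h \<in> Pk k H" "\<forall>v \<in> ball x k. fst g v = fst h v" using * by blast
  then obtain h' where "h' \<in> H" "\<forall>v \<in> ball x k. fst h v = fst h' v"
    using x Pk_iff[OF assms(1)] by blast
  with h(2) show "\<exists>h \<in> H. \<forall>v \<in> ball x k. fst g v = fst h v" by auto
qed fact

lemma Pk_subgroup:
  assumes "subgroup H Aut"
  shows "subgroup (Pk k H) Aut"
proof (rule group.subgroupI[OF group_Aut])
  have H: "H \<subseteq> aut T arev" using assms subgroup_aut by auto
  note iff = Pk_iff[OF H]
  show "Pk k H \<subseteq> carrier Aut" using Pk_aut by simp
  show "Pk k H \<noteq> {}" using Pk_superset[OF H] subgroup.one_closed[OF assms] by blast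
  show "inv\<^bsub>Aut\<^esub> g \<in> Pk k H" if g: "g \<in> Pk k H" for g
    unfolding iff
  proof (intro conjI ballI)
    have ga: "g \<in> aut T arev" using g iff by blast
    then show "inv\<^bsub>Aut\<^esub> g \<in> aut T arev" by simp
    fix x assume x: "x \<in> V"
    then have gx: "fst (inv\<^bsub>Aut\<^esub> g) x \<in> V" using ga by simp
    then obtain h where h: "h \<in> H" "\<forall>v \<in> ball (fst (inv\<^bsub>Aut\<^esub> g) x) k. fst g v = fst h v"
      using g iff by blast
    have "fst (inv\<^bsub>Aut\<^esub> g) v = fst (inv\<^bsub>Aut\<^esub> h) v" if v: "v \<in> ball x k" for v
    proof -
      have vV: "v \<in> V" and D: "D x v \<le> k" using v by (auto simp: ball_def)
      then have "fst (inv\<^bsub>Aut\<^esub> g) v \<in> ball (fst (inv\<^bsub>Aut\<^esub> g) x) k"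
        using x ga by (auto simp: ball_def)
      with h(2) have "fst h (fst (inv\<^bsub>Aut\<^esub> g) v) = v" using ga vV by auto
      then show ?thesis using aut_inv_eq[of h "fst (inv\<^bsub>Aut\<^esub> g) v" v] h(1) H ga vV by auto
    qed
    then show "\<exists>h \<in> H. \<forall>v \<in> ball x k. fst (inv\<^bsub>Aut\<^esub> g) v = fst h v"
      using h(1) subgroup.m_inv_closed[OF assms] by blast
  qed
  show "g \<otimes>\<^bsub>Aut\<^esub> g' \<in> Pk k H" if g: "g \<in> Pk k H" "g' \<in> Pk k H" for g g'
    unfolding iff
  proof (intro conjI ballI)
    have ga: "g \<in> aut T arev" "g' \<in> aut T arev" using g iff by blast+
    then show "g \<otimes>\<^bsub>Aut\<^esub> g' \<in> aut T arev" by simp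
    fix x assume x: "x \<in> V"
    then obtain h' where h': "h' \<in> H" "\<forall>v \<in> ball x k. fst g' v = fst h' v"
      using g iff by blast
    obtain h where h: "h \<in> H" "\<forall>v \<in> ball (fst g' x) k. fst g v = fst h v"
      using g iff x ga by (meson aut_V)
    have "fst (g \<otimes>\<^bsub>Aut\<^esub> g') v = fst (h \<otimes>\<^bsub>Aut\<^esub> h') v" if v: "v \<in> ball x k" for v
    proof -
      have vV: "v \<in> V" and D: "D x v \<le> k" using v by (auto simp: ball_def)
      then have "fst g' v \<in> ball (fst g' x) k" using x ga by (auto simp: ball_def)
      then have "fst g (fst g' v) = fst h (fst h' v)" using h(2) h'(2) v by auto
      moreover have "h \<in> aut T arev" "h' \<in> aut T arev" using h(1) h'(1) H by blast+
      ultimately show ?thesis using ga vV by simp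
    qed
    then show "\<exists>h \<in> H. \<forall>v \<in> ball x k. fst (g \<otimes>\<^bsub>Aut\<^esub> g') v = fst h v"
      using h(1) h'(1) subgroup.m_closed[OF assms] by blast
  qed
qed

definition half :: "'v \<Rightarrow> 'v \<Rightarrow> 'v set" where
  "half x y = {v \<in> V. D v x < D v y}"

lemma half_cases:
  assumes "x \<in> V" "y \<in> V" "D x y = 1" "v \<in> V"
  shows "v \<in> half x y \<longleftrightarrow> v \<notin> half y x"
  using D_adjacent[of v x y] assms by (auto simp: half_def)

lemma half_crossing:
  assumes "x \<in> V" "y \<in> V" "D x y = 1" "v \<in> half x y" "z \<in> half y x"
  shows "D v z = D v x + 1 + D z y"
proof -
  have "v \<in> V" "z \<in> V" using assms by (auto simp: half_def)
  moreover have "D v y = Suc (D v x)" "D z x = Suc (D z y)"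
    using D_adjacent[of v x y] D_adjacent[of z x y] assms by (auto simp: half_def)
  ultimately show ?thesis using bridge[of x y v z] assms(1-3) by blast
qed

text \<open>The edge between \<open>x\<close> and \<open>y\<close> is the only one that leaves the half-tree, and \<open>g\<close> fixes it. So
  \<open>g\<close> preserves the half-tree and its restriction can be extended by the identity.\<close>

lemma half_glue_aut:
  assumes g: "g \<in> aut T arev" and xy: "x \<in> V" "y \<in> V" "D x y = 1"
    and fixed: "fst g x = x" "fst g y = y"
  obtains g1 where "g1 \<in> aut T arev"
    "\<And>v. v \<in> V \<Longrightarrow> fst g1 v = (if v \<in> half x y then fst g v else v)"
proof -
  have inv: "fst g v \<in> half x y \<longleftrightarrow> v \<in> half x y" if "v \<in> V" for v
    using aut_D[of g v x] aut_D[of g v y] assms that by (auto simp: half_def)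
  let ?E = "{e \<in> arcs T. tail T e \<in> half x y}"
  have surjV: "fst g ` V = V" and surjE: "snd g ` arcs T = arcs T"
    using aut_Bij[OF g] by (auto simp: Bij_def bij_betw_def)
  have 1: "fst g ` half x y = half x y"
  proof
    show "half x y \<subseteq> fst g ` half x y"
    proof
      fix v assume v: "v \<in> half x y"
      then obtain u where "u \<in> V" "v = fst g u" using surjV by (auto simp: half_def)
      with v inv show "v \<in> fst g ` half x y" by auto
    qed
  qed (use inv in \<open>auto simp: half_def\<close>)
  have 2: "snd g ` ?E = ?E"
  proof
    show "?E \<subseteq> snd g ` ?E"
    proof
      fix e assume e: "e \<in> ?E"
      then obtain f where "f \<in> arcs T" "e = snd g f" using surjE by auto
      with e inv g show "e \<in> snd g ` ?E" by (auto simp: aut_ends)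
    qed
  qed (use inv g in \<open>auto simp: aut_ends\<close>)
  define g1 where "g1 = (\<lambda>v \<in> V. if v \<in> half x y then fst g v else v,
    \<lambda>e \<in> arcs T. if e \<in> ?E then snd g e else e)"
  have cross: "snd g e = e \<and> fst g (tail T e) = tail T e \<and> fst g (head T e) = head T e"
    if e: "e \<in> arcs T" "(tail T e \<in> half x y) \<noteq> (head T e \<in> half x y)" for e
  proof -
    have *: "D (tail T e) (head T e) = 1" "D (head T e) (tail T e) = 1"
      using e D_arc D_arc[of "arev e"] by auto
    have "tail T e = x \<and> head T e = y \<or> head T e = x \<and> tail T e = y"
      using e half_tree_boundary[of x y "tail T e" "head T e"]
        half_tree_boundary[of x y "head T e" "tail T e"] xy * by (auto simp: half_def)
    then have "fst g (tail T e) = tail T e \<and> fst g (head T e) = head T e" using fixed by auto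
    then show ?thesis using arc_unique[of "snd g e" e] e g by (auto simp: aut_ends)
  qed
  have "g1 \<in> aut T arev"
    unfolding aut_def
  proof (intro CollectI conjI ballI)
    show "fst g1 \<in> Bij V" unfolding g1_def fst_conv
      by (rule Bij_if) (use aut_Bij g 1 in \<open>auto simp: half_def\<close>)
    show "snd g1 \<in> Bij (arcs T)" unfolding g1_def snd_conv
      by (rule Bij_if) (use aut_Bij g 2 in \<open>auto\<close>)
    fix e assume e: "e \<in> arcs T"
    show "tail T (snd g1 e) = fst g1 (tail T e)" "head T (snd g1 e) = fst g1 (head T e)"
      using e g cross[OF e] by (auto simp: g1_def aut_ends)
    show "snd g1 (arev e) = arev (snd g1 e)"
      using e g cross[OF e] aut_arev[OF g e] by (auto simp: g1_def)
  qed
  then show ?thesis using that[of g1] by (auto simp: g1_def)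
qed

text \<open>The independence property: the part of \<open>g\<close> on one side of \<open>e\<close> lies again in the closure. On a
  ball of radius \<open>k\<close> with centre on one side it coincides with \<open>g\<close> or with the identity according
  to the side of the centre, because the vertices of this ball on the other side of \<open>e\<close> have
  distance at most \<open>k - 1\<close> from \<open>e\<close>, where \<open>g\<close> is the identity.\<close>

lemma half_glue:
  assumes H: "H \<subseteq> aut T arev" "\<one>\<^bsub>Aut\<^esub> \<in> H" and e: "e \<in> arcs T" and k: "k \<ge> 1"
    and g: "g \<in> fixator (nbhd e (k - 1)) (Pk k H)"
  obtains g1 where "g1 \<in> Pk k H"
    "\<And>v. v \<in> V \<Longrightarrow> fst g1 v = (if v \<in> half (tail T e) (head T e) then fst g v else v)"
proof -
  let ?x = "tail T e" and ?y = "head T e"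
  have xy: "?x \<in> V" "?y \<in> V" "D ?x ?y = 1" using e D_arc by auto
  have ga: "g \<in> aut T arev" and gP: "g \<in> Pk k H" and fixed: "\<And>v. v \<in> nbhd e (k - 1) \<Longrightarrow> fst g v = v"
    using g Pk_aut by (auto simp: fixator_def)
  obtain g1 where g1: "g1 \<in> aut T arev"
    "\<And>v. v \<in> V \<Longrightarrow> fst g1 v = (if v \<in> half ?x ?y then fst g v else v)"
    using half_glue_aut[OF ga xy] fixed nbhd_ends[OF e] by metis
  have "\<exists>h \<in> H. \<forall>v \<in> ball z k. fst g1 v = fst h v" if z: "z \<in> V" for z
  proof (cases "z \<in> half ?x ?y")
    case True
    obtain h where h: "h \<in> H" "\<forall>v \<in> ball z k. fst g v = fst h v" using gP z Pk_iff[OF H(1)] by blast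
    have "fst g1 v = fst g v" if v: "v \<in> ball z k" for v
    proof (cases "v \<in> half ?x ?y")
      case False
      then have "v \<in> half ?y ?x" and vV: "v \<in> V" using v xy half_cases by (auto simp: ball_def)
      then have "D z v = D z ?x + 1 + D v ?y" using half_crossing[OF xy True] by blast
      moreover have "D v ?y = D ?y v" "D z v \<le> k" using v vV xy D_commute by (auto simp: ball_def)
      ultimately have "D ?y v \<le> k - 1" by linarith
      then have "v \<in> nbhd e (k - 1)" using vV by (auto simp: nbhd_def ball_def)
      then show ?thesis using fixed g1(2) vV by simp
    qed (use v g1 in \<open>auto simp: ball_def\<close>)
    with h show ?thesis by auto
  next
    case False
    have "fst g1 v = v" if v: "v \<in> ball z k" for v
    proof (cases "v \<in> half ?x ?y")
      case True
      have vV: "v \<in> V" "D z v \<le> k" using v by (auto simp: ball_def)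
      have "z \<in> half ?y ?x" using False z xy half_cases by auto
      then have "D v z = D v ?x + 1 + D z ?y" using half_crossing[OF xy True] by blast
      moreover have "D v ?x = D ?x v" "D v z = D z v" using vV z xy D_commute by blast+
      ultimately have "D ?x v \<le> k - 1" using vV by linarith
      then have "v \<in> nbhd e (k - 1)" using vV by (auto simp: nbhd_def ball_def)
      then show ?thesis using fixed g1(2) vV by simp
    qed (use v g1 in \<open>auto simp: ball_def\<close>)
    then show ?thesis using H(2) by (intro bexI[of _ "\<one>\<^bsub>Aut\<^esub>"]) (auto simp: ball_def)
  qed
  then have "g1 \<in> Pk k H" using g1(1) Pk_iff[OF H(1)] by auto
  then show ?thesis using that g1(2) by auto
qed

lemma deep_in_half:
  assumes "x \<in> V" "y \<in> V" "D x y = 1" "d \<ge> 2"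
  obtains f where "f \<in> arcs T" "nbhd f n \<subseteq> half y x"
proof -
  have "\<exists>z \<in> V. D x z = Suc m \<and> D y z = m" for m
  proof (induction m)
    case 0
    then show ?case using assms by auto
  next
    case (Suc m)
    then obtain z where z: "z \<in> V" "D x z = Suc m" "D y z = m" by blast
    then have "x \<noteq> z" using assms by auto
    then have "card (forward x z) > 0" using card_forward[of x z] z assms by auto
    then obtain w where "w \<in> forward x z" by (metis card_gt_0_iff ex_in_conv)
    then have w: "w \<in> V" "D z w = 1" "D x w = Suc (Suc m)" using z by (auto simp: forward_def)
    then have "D y w = Suc m"
      using z assms D_triangle[of y z w] D_triangle[of x y w] by auto
    with w show ?case by auto
  qed
  then obtain z where z: "z \<in> V" "D x z = Suc (Suc n)" "D y z = Suc n" by blast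
  have "card (out_arcs T z) > 0" using regular[OF z(1)] assms by auto
  then obtain f where f: "f \<in> arcs T" "tail T f = z" by (metis card_gt_0_iff ex_in_conv in_out_arcs_conv)
  have zy: "z \<in> half y x" "D z y = Suc n" using z assms D_commute[of z] by (auto simp: half_def)
  have "nbhd f n \<subseteq> half y x"
  proof
    fix v assume "v \<in> nbhd f n"
    then have v: "v \<in> V" "D z v \<le> Suc n" using nbhd_subset_ball[OF f(1), of n] f(2) by (auto simp: ball_def)
    show "v \<in> half y x"
    proof (rule ccontr)
      assume "v \<notin> half y x"
      then have "v \<in> half x y" using half_cases assms v by auto
      then have "D v z = D v x + 1 + D z y" using half_crossing[OF assms(1-3) _ zy(1)] by blast
      moreover have "D v z = D z v" using D_commute v z by blast
      ultimately show False using v zy by linarith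
    qed
  qed
  with f that show ?thesis by blast
qed

text \<open>Suppose the larger closure has no new elements that fix the neighbourhood of radius \<open>l - 1\<close> of an
  edge. By independence an element of the larger closure that fixes the neighbourhood of radius
  \<open>k - 1\<close> of an edge is a product of two elements supported on opposite half-trees; each of them is
  of the former kind, for an edge deep in the complementary half-tree. As every element agrees with
  one of \<open>H\<close> on a ball of radius \<open>k\<close>, both closures coincide.\<close>

lemma Pk_eqI:
  assumes H: "subgroup H Aut" and kl: "1 \<le> k" "k \<le> l" and d: "d \<ge> 2"
    and sub: "\<And>e. e \<in> arcs T \<Longrightarrow> fixator (nbhd e (l - 1)) (Pk k H) \<subseteq> Pk l H"
  shows "Pk k H = Pk l H"
proof
  have Ha: "H \<subseteq> aut T arev" using H subgroup_aut by auto
  then show "Pk l H \<subseteq> Pk k H" using Pk_antimono kl by auto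
  have sg: "subgroup (Pk n H) Aut" for n using Pk_subgroup H by auto
  have one: "\<one>\<^bsub>Aut\<^esub> \<in> H" using H subgroup.one_closed by auto
  have part: "\<exists>g1 \<in> Pk l H. \<forall>v \<in> V. fst g1 v = (if v \<in> half (tail T e) (head T e) then fst g v else v)"
    if e: "e \<in> arcs T" and g: "g \<in> fixator (nbhd e (k - 1)) (Pk k H)" for e g
  proof -
    have xy: "tail T e \<in> V" "head T e \<in> V" "D (tail T e) (head T e) = 1" using e D_arc by auto
    obtain g1 where g1: "g1 \<in> Pk k H"
      "\<And>v. v \<in> V \<Longrightarrow> fst g1 v = (if v \<in> half (tail T e) (head T e) then fst g v else v)"
      using half_glue[OF Ha one e kl(1) g] by blast
    obtain f where f: "f \<in> arcs T" "nbhd f (l - 1) \<subseteq> half (head T e) (tail T e)"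
      using deep_in_half[OF xy d] by blast
    have "fst g1 v = v" if "v \<in> nbhd f (l - 1)" for v
      using that f(2) g1(2)[of v] half_cases[OF xy, of v] by (auto simp: half_def)
    then have "g1 \<in> Pk l H" using sub[OF f(1)] g1(1) by (auto simp: fixator_def)
    with g1(2) show ?thesis by blast
  qed
  show "Pk k H \<subseteq> Pk l H"
  proof
    fix g assume g: "g \<in> Pk k H"
    obtain x where x: "x \<in> V" using vertex_exists by auto
    have "card (out_arcs T x) > 0" using regular[OF x] d by auto
    then obtain e where e: "e \<in> arcs T" "tail T e = x" by (metis card_gt_0_iff ex_in_conv in_out_arcs_conv)
    obtain h where h: "h \<in> H" "\<forall>v \<in> ball x k. fst g v = fst h v" using g x Pk_iff[OF Ha] by blast
    have hP: "h \<in> Pk n H" for n using h(1) Pk_superset[OF Ha] by auto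
    have ga: "g \<in> aut T arev" "h \<in> aut T arev" using g hP Pk_aut by blast+
    define g' where "g' = inv\<^bsub>Aut\<^esub> h \<otimes>\<^bsub>Aut\<^esub> g"
    have g'P: "g' \<in> Pk k H"
      unfolding g'_def using subgroup.m_closed[OF sg] subgroup.m_inv_closed[OF sg] g hP by auto
    then have g'a: "g' \<in> aut T arev" using Pk_aut by auto
    have "fst g' v = v" if "v \<in> nbhd e (k - 1)" for v
    proof -
      have "v \<in> ball x k" using that nbhd_subset_ball[OF e(1), of "k - 1"] e(2) kl by auto
      then show ?thesis using h(2) ga by (auto simp: g'_def ball_def)
    qed
    then have fixed: "g' \<in> fixator (nbhd e (k - 1)) (Pk k H)" using g'P by (auto simp: fixator_def)
    obtain g1 where g1: "g1 \<in> Pk l H"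
      "\<forall>v \<in> V. fst g1 v = (if v \<in> half (tail T e) (head T e) then fst g' v else v)"
      using part[OF e(1) fixed] by blast
    obtain g2 where g2: "g2 \<in> Pk l H"
      "\<forall>v \<in> V. fst g2 v = (if v \<in> half (head T e) (tail T e) then fst g' v else v)"
      using part[of "arev e" g'] fixed e(1) by (auto simp: nbhd_arev)
    have xy: "tail T e \<in> V" "head T e \<in> V" "D (tail T e) (head T e) = 1" using e D_arc by auto
    have g12a: "g1 \<in> aut T arev" "g2 \<in> aut T arev" using g1(1) g2(1) Pk_aut by blast+
    have "g' = g1 \<otimes>\<^bsub>Aut\<^esub> g2"
    proof (rule aut_eqI)
      fix v assume v: "v \<in> V"
      have "fst g' (tail T e) = tail T e" "fst g' (head T e) = head T e"
        using fixed nbhd_ends[OF e(1)] by (auto simp: fixator_def)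
      then have "fst g' v \<in> half (head T e) (tail T e) \<longleftrightarrow> v \<in> half (head T e) (tail T e)"
        using aut_D[OF g'a v, of "tail T e"] aut_D[OF g'a v, of "head T e"] xy g'a v
        by (auto simp: half_def)
      then show "fst g' v = fst (g1 \<otimes>\<^bsub>Aut\<^esub> g2) v"
        using g1 g2 g12a g'a v half_cases[OF xy v] half_cases[OF xy, of "fst g' v"] by auto
    qed (use g'a g12a in auto)
    then have "g' \<in> Pk l H" using g1 g2 subgroup.m_closed[OF sg] by auto
    then have "h \<otimes>\<^bsub>Aut\<^esub> g' \<in> Pk l H" using hP subgroup.m_closed[OF sg] by auto
    moreover have "h \<otimes>\<^bsub>Aut\<^esub> g' = g" by (rule aut_eqI) (use ga in \<open>auto simp: g'_def\<close>)
    ultimately show "g \<in> Pk l H" by simp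
  qed
qed

end


section \<open>The permutation topology\<close>

context regular_tree
begin

lemma openin_perm_topology_agree:
  assumes "finite A" "A \<subseteq> V"
  shows "openin (perm_topology T G) {h \<in> G. \<forall>v \<in> A. fst h v = p v}"
  unfolding perm_topology_def
  by (rule topology_generated_by_Basis, intro CollectI exI[of _ A] exI[of _ "{} :: 'e set"]
      exI[of _ p] exI[of _ "id :: 'e \<Rightarrow> 'e"]) (use assms in simp)

lemma topspace_perm_topology [simp]: "topspace (perm_topology T G) = G"
proof
  show "topspace (perm_topology T G) \<subseteq> G"
    unfolding perm_topology_def topology_generated_by_topspace by blast
  show "G \<subseteq> topspace (perm_topology T G)"
    using openin_subset[OF openin_perm_topology_agree[of "{}" G undefined]] by simp
qed

text \<open>An arc is determined by its ends, so vertices alone give a neighbourhood base.\<close>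

lemma perm_topology_neighbourhood:
  assumes "openin (perm_topology T G) U" "g \<in> U" "G \<subseteq> aut T arev"
  shows "\<exists>A. finite A \<and> A \<subseteq> V \<and> {h \<in> G. \<forall>v \<in> A. fst h v = fst g v} \<subseteq> U"
proof -
  have "g \<in> G" using openin_subset[OF assms(1)] assms(2) by auto
  define \<S> where "\<S> = {{h \<in> G. (\<forall>v \<in> A. fst h v = p v) \<and> (\<forall>e \<in> B. snd h e = q e)} | A B p q.
        finite A \<and> A \<subseteq> V \<and> finite B \<and> B \<subseteq> arcs T}"
  define N where "N A = {h \<in> G. \<forall>v \<in> A. fst h v = fst g v}" for A
  have "generate_topology_on \<S> U"
    using assms(1) unfolding perm_topology_def \<S>_def[symmetric] openin_topology_generated_by_iff .
  then have "\<exists>A. finite A \<and> A \<subseteq> V \<and> N A \<subseteq> U" using assms(2)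
  proof induction
    case Empty
    then show ?case by simp
  next
    case (Int a b)
    then obtain A B where AB: "finite A" "A \<subseteq> V" "N A \<subseteq> a" "finite B" "B \<subseteq> V" "N B \<subseteq> b" by blast
    moreover have "N (A \<union> B) = N A \<inter> N B" by (auto simp: N_def)
    ultimately show ?case by (intro exI[of _ "A \<union> B"]) auto
  next
    case (UN K)
    then obtain k where "k \<in> K" "g \<in> k" by blast
    with UN.IH[of k] obtain A where "finite A" "A \<subseteq> V" "N A \<subseteq> k" by blast
    then show ?case using \<open>k \<in> K\<close> by (intro exI[of _ A]) auto
  next
    case (Basis s)
    then obtain A B p q where s: "s = {h \<in> G. (\<forall>v \<in> A. fst h v = p v) \<and> (\<forall>e \<in> B. snd h e = q e)}"
      and fin: "finite A" "A \<subseteq> V" "finite B" "B \<subseteq> arcs T"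
      unfolding \<S>_def by blast
    let ?A = "A \<union> tail T ` B \<union> head T ` B"
    have "N ?A \<subseteq> s"
    proof
      fix h assume h: "h \<in> N ?A"
      have "snd h e = snd g e" if "e \<in> B" for e
        by (rule aut_arc_eq) (use h that \<open>g \<in> G\<close> assms(3) fin in \<open>auto simp: N_def\<close>)
      then show "h \<in> s" using h Basis.prems s by (auto simp: N_def)
    qed
    then show ?case using fin by (intro exI[of _ ?A]) auto
  qed
  then show ?thesis by (simp add: N_def)
qed

text \<open>If the fixator of a ball is trivial, then its cosets are the singletons, and they are open.\<close>

lemma nondiscrete_fixator:
  assumes H: "subgroup H Aut" and nd: "perm_topology T H \<noteq> discrete_topology H" and x: "x \<in> V"
  obtains h where "h \<in> fixator (ball x n) H" "h \<noteq> \<one>\<^bsub>Aut\<^esub>"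
proof -
  have "\<exists>h \<in> fixator (ball x n) H. h \<noteq> \<one>\<^bsub>Aut\<^esub>"
  proof (rule ccontr)
    assume trivial: "\<not> (\<exists>h \<in> fixator (ball x n) H. h \<noteq> \<one>\<^bsub>Aut\<^esub>)"
    have "openin (perm_topology T H) {h}" if h: "h \<in> H" for h
    proof -
      have "{g \<in> H. \<forall>v \<in> ball x n. fst g v = fst h v} \<subseteq> {h}"
      proof
        fix g assume g: "g \<in> {g \<in> H. \<forall>v \<in> ball x n. fst g v = fst h v}"
        have a: "g \<in> aut T arev" "h \<in> aut T arev" using g h subgroup_aut[OF H] by auto
        have "inv\<^bsub>Aut\<^esub> h \<otimes>\<^bsub>Aut\<^esub> g \<in> H"
          using g h subgroup.m_closed[OF H] subgroup.m_inv_closed[OF H] by auto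
        then have "inv\<^bsub>Aut\<^esub> h \<otimes>\<^bsub>Aut\<^esub> g \<in> fixator (ball x n) H"
          using g a by (auto simp: fixator_def ball_def)
        then have one: "inv\<^bsub>Aut\<^esub> h \<otimes>\<^bsub>Aut\<^esub> g = \<one>\<^bsub>Aut\<^esub>" using trivial by blast
        have "g = h"
        proof (rule aut_eqI)
          fix v assume v: "v \<in> V"
          have "fst (inv\<^bsub>Aut\<^esub> h) (fst g v) = v" using one v a aut_mult(1)[of "inv\<^bsub>Aut\<^esub> h" g v] by simp
          then show "fst g v = fst h v" using aut_inv_eq[of h v "fst g v"] v a by simp
        qed (use a in auto)
        then show "g \<in> {h}" by simp
      qed
      then have "{g \<in> H. \<forall>v \<in> ball x n. fst g v = fst h v} = {h}" using h by auto
      moreover have "openin (perm_topology T H) {g \<in> H. \<forall>v \<in> ball x n. fst g v = fst h v}"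
        by (rule openin_perm_topology_agree[OF finite_ball[OF x] ball_V])
      ultimately show ?thesis by simp
    qed
    then show False using nd discrete_topology_unique[of H "perm_topology T H"] by auto
  qed
  with that show ?thesis by blast
qed

end

section \<open>Transitivity of the given group\<close>

lemma (in group) normal_in_subgroupI:
  assumes "subgroup N G" "subgroup K G" "N \<subseteq> K"
    and "\<And>x h. x \<in> K \<Longrightarrow> h \<in> N \<Longrightarrow> x \<otimes> h \<otimes> inv x \<in> N"
  shows "N \<lhd> G\<lparr>carrier := K\<rparr>"
proof -
  interpret K: group "G\<lparr>carrier := K\<rparr>" by (rule subgroup_imp_group[OF assms(2)])
  show ?thesis
    unfolding K.normal_inv_iff
    using subgroup_incl[OF assms(1-3)] assms(4) m_inv_consistent[OF assms(2)] by simp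
qed

context regular_tree
begin

lemma aut_ball:
  assumes "g \<in> aut T arev" "x \<in> V"
  shows "fst g ` ball x n = ball (fst g x) n"
proof
  show "fst g ` ball x n \<subseteq> ball (fst g x) n" using assms by (auto simp: ball_def)
  show "ball (fst g x) n \<subseteq> fst g ` ball x n"
  proof
    fix v assume "v \<in> ball (fst g x) n"
    then have v: "v \<in> V" "D (fst g x) v \<le> n" by (auto simp: ball_def)
    then have "D x (fst (inv\<^bsub>Aut\<^esub> g) v) \<le> n"
      using aut_D[of g x "fst (inv\<^bsub>Aut\<^esub> g) v"] assms by simp
    then show "v \<in> fst g ` ball x n"
      using v assms by (intro image_eqI[of _ _ "fst (inv\<^bsub>Aut\<^esub> g) v"]) (auto simp: ball_def)
  qed
qed

lemma sphere_1_arc: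
  assumes "x \<in> V" "u \<in> sphere x 1"
  obtains e where "e \<in> out_arcs T x" "head T e = u"
proof -
  have "u \<in> head T ` out_arcs T x"
    using bij_betw_imp_surj_on[OF sphere_1_head[OF assms(1)]] assms(2) by simp
  then show ?thesis using that by (metis imageE)
qed

lemma local_transitive:
  assumes "locally_perm_isomorphic T H \<Omega> F" "transitive_on \<Omega> F" "H \<subseteq> aut T arev" "x \<in> V"
    and "u \<in> sphere x 1" "w \<in> sphere x 1"
  obtains h where "h \<in> H" "fst h x = x" "fst h u = w"
proof -
  obtain \<phi> \<psi> where \<phi>: "bij_betw \<phi> (out_arcs T x) \<Omega>"
    and \<psi>: "\<psi> \<in> iso (BijGroup (out_arcs T x)\<lparr>carrier := local_action T H x\<rparr>) (BijGroup \<Omega>\<lparr>carrier := F\<rparr>)"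
    and eq: "\<forall>p \<in> local_action T H x. \<forall>e \<in> out_arcs T x. \<phi> (p e) = \<psi> p (\<phi> e)"
    using assms(1,4) unfolding locally_perm_isomorphic_def perm_isomorphic_def by blast
  obtain e f where ef: "e \<in> out_arcs T x" "head T e = u" "f \<in> out_arcs T x" "head T f = w"
    using sphere_1_arc assms(4-6) by metis
  then have "\<phi> e \<in> \<Omega>" "\<phi> f \<in> \<Omega>" using \<phi> by (auto simp: bij_betw_def)
  then obtain p where "p \<in> F" "p (\<phi> e) = \<phi> f" using assms(2) by (auto simp: transitive_on_def)
  moreover have "\<psi> ` local_action T H x = F" using \<psi> by (auto simp: iso_def bij_betw_def)
  ultimately obtain q where q: "q \<in> local_action T H x" "\<psi> q (\<phi> e) = \<phi> f" by blast
  then obtain h where h: "h \<in> H" "fst h x = x" "q = restrict (snd h) (out_arcs T x)"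
    by (auto simp: local_action_def)
  have ha: "h \<in> aut T arev" using h assms by auto
  have "\<phi> (snd h e) = \<phi> f" using eq q h ef(1) by (metis restrict_apply')
  moreover have "snd h e \<in> out_arcs T x" using h ha ef by (auto simp: aut_ends)
  ultimately have "snd h e = f" using \<phi> ef by (auto simp: bij_betw_def dest: inj_onD)
  then have "fst h u = w" using aut_ends(2)[OF ha, of e] ef by auto
  with h that show ?thesis by blast
qed

text \<open>Let \<open>y\<close> be at distance \<open>m\<close> from \<open>x\<close> and let \<open>q i\<close> be the vertex at distance \<open>i\<close> from \<open>y\<close>
  on the geodesic to \<open>x\<close>. The fixator of the ball of radius \<open>i\<close> around \<open>q i\<close> fixes \<open>q (i + 1)\<close>, hence
  normalises the fixator of the ball of radius \<open>i + 1\<close> around \<open>q (i + 1)\<close>, which it contains.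
  So the fixator of the ball of radius \<open>m\<close> around \<open>x\<close> is subnormal in the stabiliser of the edge
  from \<open>y\<close> to \<open>q 1\<close>, and acts on the edges at \<open>y\<close> as a subnormal subgroup of a point stabiliser
  in \<open>F\<close>.\<close>

lemma fixator_transitive_on_forward:
  assumes H: "subgroup H Aut" and F: "subgroup F (BijGroup \<Omega>)"
    and lpi: "locally_perm_isomorphic T H \<Omega> F"
    and subn: "\<And>\<omega> N. \<omega> \<in> \<Omega> \<Longrightarrow> subnormal N (BijGroup \<Omega> \<lparr>carrier := point_stab F \<omega>\<rparr>) \<Longrightarrow>
           N \<noteq> {\<one>\<^bsub>BijGroup \<Omega>\<^esub>} \<Longrightarrow> transitive_on (\<Omega> - {\<omega>}) N"
    and xy: "x \<in> V" "y \<in> V" "D x y = m" "m \<ge> 1"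
    and h: "h \<in> fixator (ball x m) H" "u \<in> sphere y 1" "fst h u \<noteq> u"
    and w: "w \<in> forward x y" "w' \<in> forward x y"
  obtains g where "g \<in> fixator (ball x m) H" "fst g w = w'"
proof -
  have Ha: "H \<subseteq> aut T arev" using H subgroup_aut by auto
  obtain q where q: "\<And>i. q i \<in> V \<and> D x (q i) = m - i \<and> (i = 0 \<longrightarrow> q i = y)"
    "\<And>i. i < m \<Longrightarrow> D (q i) (q (Suc i)) = 1"
  proof -
    have "\<exists>q. \<forall>i. (q i \<in> V \<and> D x (q i) = m - i \<and> (i = 0 \<longrightarrow> q i = y)) \<and>
        (i < m \<longrightarrow> D (q i) (q (Suc i)) = 1)"
    proof (rule dependent_nat_choice)
      fix v i assume v: "v \<in> V \<and> D x v = m - i \<and> (i = 0 \<longrightarrow> v = y)"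
      show "\<exists>z. (z \<in> V \<and> D x z = m - Suc i \<and> (Suc i = 0 \<longrightarrow> z = y)) \<and> (i < m \<longrightarrow> D v z = 1)"
      proof (cases "i < m")
        case True
        then have "D x v = Suc (m - Suc i)" using v by simp
        then obtain z where "z \<in> V" "D x z = m - Suc i" "D z v = 1"
          using pred_exists v xy(1) by metis
        then show ?thesis using v D_commute by auto
      next
        case False
        then show ?thesis using v by auto
      qed
    qed (use xy in auto)
    then show ?thesis using that by blast
  qed
  \<comment> \<open>For \<open>i \<ge> m\<close> the truncated difference puts \<open>q i\<close> at \<open>x\<close>.\<close>
  have q0: "q 0 = y" and qm: "q m = x" using q(1)[of 0] q(1)[of m] xy D_eq_0 by auto
  have q1: "q 1 \<in> V" "D y (q 1) = 1" "D x y = Suc (D x (q 1))"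
    using q(1)[of 1] q(2)[of 0] xy q0 by auto
  have qy: "D (q i) y \<le> i" if "i \<le> m" for i
    using that
  proof (induction i)
    case (Suc i)
    then have "D (q (Suc i)) y \<le> D (q (Suc i)) (q i) + D (q i) y" using q(1) xy D_triangle by blast
    moreover have "D (q (Suc i)) (q i) = 1" using q Suc.prems D_commute by (metis Suc_le_lessD)
    ultimately show ?case using Suc by simp
  qed (use q0 xy in simp)
  have ball_mono: "ball (q i) i \<subseteq> ball (q (Suc i)) (Suc i)" if "i < m" for i
  proof
    fix v assume v: "v \<in> ball (q i) i"
    have "D (q (Suc i)) (q i) = 1" using q that D_commute by metis
    then show "v \<in> ball (q (Suc i)) (Suc i)"
      using v q(1) D_triangle[of "q (Suc i)" "q i" v] by (auto simp: ball_def)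
  qed
  let ?E = "out_arcs T y"
  obtain \<phi> \<psi> where \<phi>: "bij_betw \<phi> ?E \<Omega>"
    and \<psi>: "\<psi> \<in> iso (BijGroup ?E\<lparr>carrier := local_action T H y\<rparr>) (BijGroup \<Omega>\<lparr>carrier := F\<rparr>)"
    and eq: "\<forall>p \<in> local_action T H y. \<forall>e \<in> ?E. \<phi> (p e) = \<psi> p (\<phi> e)"
    using lpi xy(2) unfolding locally_perm_isomorphic_def perm_isomorphic_def by blast
  have \<psi>F: "\<psi> ` local_action T H y = F" using \<psi> by (auto simp: iso_def bij_betw_def)
  define \<theta> where "\<theta> g = \<psi> (restrict (snd g) ?E)" for g :: "('v \<Rightarrow> 'v) \<times> ('e \<Rightarrow> 'e)"
  have la: "restrict (snd g) ?E \<in> local_action T H y" if "g \<in> fixator {y} H" for g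
    using that unfolding local_action_def fixator_def by blast
  have outE: "snd g e \<in> ?E" if "g \<in> fixator {y} H" "e \<in> ?E" for g e
    using that Ha by (auto simp: fixator_def aut_ends)
  have \<theta>_apply: "\<phi> (snd g e) = \<theta> g (\<phi> e)" if "g \<in> fixator {y} H" "e \<in> ?E" for g e
    using eq la[OF that(1)] that(2) unfolding \<theta>_def by (metis restrict_apply')
  have \<phi>_eq: "\<phi> e = \<phi> f \<longleftrightarrow> e = f" if "e \<in> ?E" "f \<in> ?E" for e f
    using \<phi> that by (auto simp: bij_betw_def dest: inj_onD)
  have \<phi>\<Omega>: "\<phi> e \<in> \<Omega>" if "e \<in> ?E" for e using \<phi> that by (auto simp: bij_betw_def)
  have BijE: "restrict (snd g) ?E \<in> Bij ?E" if g: "g \<in> fixator {y} H" for g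
  proof -
    have "g \<in> aut T arev" using g Ha by (auto simp: fixator_def)
    then have "inj_on (snd g) (arcs T)" using aut_Bij(2)[of g] by (auto simp: Bij_def bij_betw_def)
    then have "inj_on (snd g) ?E" by (auto simp: inj_on_def)
    moreover have "snd g ` ?E \<subseteq> ?E" using outE[OF g] by auto
    ultimately have "bij_betw (snd g) ?E ?E"
      using regular[OF xy(2)] by (auto simp: bij_betw_def endo_inj_surj)
    then show ?thesis by (simp add: Bij_def)
  qed
  have \<theta>_mult: "\<theta> (g1 \<otimes>\<^bsub>Aut\<^esub> g2) = \<theta> g1 \<otimes>\<^bsub>BijGroup \<Omega>\<^esub> \<theta> g2"
    if g: "g1 \<in> fixator {y} H" "g2 \<in> fixator {y} H" for g1 g2
  proof -
    have a: "g1 \<in> aut T arev" "g2 \<in> aut T arev" using g Ha by (auto simp: fixator_def)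
    have "restrict (snd (g1 \<otimes>\<^bsub>Aut\<^esub> g2)) ?E = compose ?E (restrict (snd g1) ?E) (restrict (snd g2) ?E)"
      using a outE[OF g(2)] by (auto simp: compose_def fun_eq_iff)
    also have "\<dots> = restrict (snd g1) ?E \<otimes>\<^bsub>BijGroup ?E\<^esub> restrict (snd g2) ?E"
      using BijE[OF g(1)] BijE[OF g(2)] by (simp add: BijGroup_def)
    finally show ?thesis
      using \<psi> la[OF g(1)] la[OF g(2)] by (auto simp: \<theta>_def iso_def hom_def)
  qed
  have \<theta>F: "\<theta> g \<in> F" if "g \<in> fixator {y} H" for g using la[OF that] \<psi>F by (auto simp: \<theta>_def)
  have FB: "F \<subseteq> carrier (BijGroup \<Omega>)" using F by (rule subgroup.subset)
  obtain e0 where e0: "e0 \<in> ?E" "head T e0 = q 1"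
    using sphere_1_arc[OF xy(2), of "q 1"] q1 by (auto simp: sphere_def)
  define \<omega> where "\<omega> = \<phi> e0"
  \<comment> \<open>The chain starts with the stabiliser of an edge, which induces the full point stabiliser
    in \<open>F\<close>; the fixator of a ball of radius \<open>0\<close> would be the whole stabiliser of \<open>y\<close>.\<close>
  define K where "K i = (if i = 0 then fixator {y, q 1} H else fixator (ball (q i) i) H)" for i
  have Ksub: "subgroup (K i) Aut" for i
    using fixator_subgroup[OF H] ball_V q1 xy unfolding K_def by auto
  have Ky: "K i \<subseteq> fixator {y} H" if "i \<le> m" for i
    using qy[OF that] xy by (auto simp: K_def fixator_def ball_def)
  have Kanti: "K (Suc i) \<subseteq> K i" if "i < m" for i
  proof (cases "i = 0")
    case True
    then show ?thesis using q1 xy D_commute by (auto simp: K_def fixator_def ball_def)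
  next
    case False
    then show ?thesis using ball_mono[OF that] by (auto simp: K_def fixator_def)
  qed
  have Knormal: "K (Suc i) \<lhd> Aut\<lparr>carrier := K i\<rparr>" if i: "i < m" for i
  proof (rule group.normal_in_subgroupI[OF group_Aut Ksub Ksub Kanti[OF i]])
    fix g k assume g: "g \<in> K i" and k: "k \<in> K (Suc i)"
    have gH: "g \<in> H" "g \<in> aut T arev" using g Ha by (auto simp: K_def fixator_def split: if_splits)
    have "fst g (q (Suc i)) = q (Suc i)"
    proof (cases "i = 0")
      case False
      then have "q (Suc i) \<in> ball (q i) i" using q i by (auto simp: ball_def)
      then show ?thesis using g False by (auto simp: K_def fixator_def)
    qed (use g in \<open>auto simp: K_def fixator_def\<close>)
    then have "fst g ` ball (q (Suc i)) (Suc i) = ball (q (Suc i)) (Suc i)"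
      using aut_ball gH q(1) by metis
    then show "g \<otimes>\<^bsub>Aut\<^esub> k \<otimes>\<^bsub>Aut\<^esub> inv\<^bsub>Aut\<^esub> g \<in> K (Suc i)"
      using fixator_conj[OF H gH(1) _ ball_V, of k "q (Suc i)" "Suc i"] k by (simp add: K_def)
  qed
  have \<theta>hom: "group_hom (Aut\<lparr>carrier := K i\<rparr>) (BijGroup \<Omega>) \<theta>" if i: "i \<le> m" for i
  proof -
    have "\<theta> \<in> hom (Aut\<lparr>carrier := K i\<rparr>) (BijGroup \<Omega>)"
    proof (rule homI)
      fix g assume "g \<in> carrier (Aut\<lparr>carrier := K i\<rparr>)"
      then have g: "g \<in> fixator {y} H" using Ky[OF i] by auto
      then show "\<theta> g \<in> carrier (BijGroup \<Omega>)" using \<theta>F FB by blast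
      fix g' assume "g' \<in> carrier (Aut\<lparr>carrier := K i\<rparr>)"
      then have "g' \<in> fixator {y} H" using Ky[OF i] by auto
      with g show "\<theta> (g \<otimes>\<^bsub>Aut\<lparr>carrier := K i\<rparr>\<^esub> g') = \<theta> g \<otimes>\<^bsub>BijGroup \<Omega>\<^esub> \<theta> g'"
        using \<theta>_mult by simp
    qed
    then show ?thesis
      using group.subgroup_imp_group[OF group_Aut Ksub] group_BijGroup
      by (auto simp: group_hom_def group_hom_axioms_def)
  qed
  define S where "S i = \<theta> ` K i" for i
  have Ssub: "subgroup (S i) (BijGroup \<Omega>)" if "i \<le> m" for i
    using group_hom.img_is_subgroup[OF \<theta>hom[OF that]] by (simp add: S_def)
  have Snormal: "S (Suc i) \<lhd> BijGroup \<Omega>\<lparr>carrier := S i\<rparr>" if i: "i < m" for i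
    unfolding S_def[of "Suc i"]
  proof (rule normal.surj_hom_normal_subgroup[OF Knormal[OF i]])
    have "\<theta> \<in> hom (Aut\<lparr>carrier := K i\<rparr>) (BijGroup \<Omega>\<lparr>carrier := S i\<rparr>)"
      using group_hom.homh[OF \<theta>hom[of i]] i by (auto simp: hom_def S_def)
    then show "group_hom (Aut\<lparr>carrier := K i\<rparr>) (BijGroup \<Omega>\<lparr>carrier := S i\<rparr>) \<theta>"
      using group.subgroup_imp_group[OF group_Aut Ksub] i
        group.subgroup_imp_group[OF group_BijGroup Ssub]
      by (auto simp: group_hom_def group_hom_axioms_def)
  qed (simp add: S_def)
  have S0: "S 0 = point_stab F \<omega>"
  proof
    have *: "snd g e0 = e0 \<longleftrightarrow> fst g (q 1) = q 1" if g: "g \<in> fixator {y} H" for g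
    proof -
      have ga: "g \<in> aut T arev" "fst g y = y" using g Ha by (auto simp: fixator_def)
      have ends: "tail T (snd g e0) = y" "head T (snd g e0) = fst g (q 1)"
        and arcs: "snd g e0 \<in> arcs T" "e0 \<in> arcs T" "tail T e0 = y"
        using aut_ends[OF ga(1), of e0] e0 ga by auto
      show ?thesis
      proof
        assume "fst g (q 1) = q 1"
        then show "snd g e0 = e0"
          by (intro arc_unique) (simp_all add: ends arcs e0(2))
      qed (use ends e0 in simp)
    qed
    show "S 0 \<subseteq> point_stab F \<omega>"
    proof
      fix f assume "f \<in> S 0"
      then obtain g where g: "f = \<theta> g" "g \<in> fixator {y} H" "fst g (q 1) = q 1"
        by (auto simp: S_def K_def fixator_def)
      then show "f \<in> point_stab F \<omega>"
        using \<theta>_apply[OF g(2) e0(1)] *[OF g(2)] \<theta>F[OF g(2)] by (simp add: point_stab_def \<omega>_def)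
    qed
    show "point_stab F \<omega> \<subseteq> S 0"
    proof
      fix f assume "f \<in> point_stab F \<omega>"
      then have f: "f \<in> F" "f \<omega> = \<omega>" by (auto simp: point_stab_def)
      then obtain p where p: "p \<in> local_action T H y" "f = \<psi> p" using \<psi>F by auto
      then obtain g where g: "p = restrict (snd g) ?E" "g \<in> fixator {y} H"
        by (auto simp: local_action_def fixator_def)
      then have "\<phi> (snd g e0) = \<phi> e0" using f p \<theta>_apply[OF g(2) e0(1)] by (simp add: \<theta>_def \<omega>_def)
      then have "fst g (q 1) = q 1" using * \<phi>_eq outE e0 g by metis
      then have "g \<in> K 0" using g by (auto simp: K_def fixator_def)
      then show "f \<in> S 0" using p g by (auto simp: S_def \<theta>_def)
    qed
  qed
  have Km: "K m = fixator (ball x m) H" using xy(4) qm by (simp add: K_def)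
  have "subnormal (S m) (BijGroup \<Omega> \<lparr>carrier := point_stab F \<omega>\<rparr>)"
    unfolding subnormal_def
    by (intro exI[of _ m] exI[of _ S]) (use S0 Snormal in simp)
  moreover have "S m \<noteq> {\<one>\<^bsub>BijGroup \<Omega>\<^esub>}"
  proof -
    obtain e where e: "e \<in> ?E" "head T e = u" using sphere_1_arc xy(2) h(2) by metis
    have hy: "h \<in> fixator {y} H" "h \<in> aut T arev" using h(1) Ky[of m] Km Ha by (auto simp: fixator_def)
    have "snd h e \<noteq> e" using aut_ends(2)[OF hy(2), of e] e h(3) by auto
    then have "\<theta> h (\<phi> e) \<noteq> \<phi> e" using \<theta>_apply[OF hy(1) e(1)] \<phi>_eq outE[OF hy(1) e(1)] e by auto
    moreover have "\<one>\<^bsub>BijGroup \<Omega>\<^esub> (\<phi> e) = \<phi> e" using \<phi>\<Omega>[OF e(1)] by (simp add: BijGroup_def)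
    moreover have "\<theta> h \<in> S m" using h(1) Km by (simp add: S_def)
    ultimately show ?thesis by auto
  qed
  ultimately have trans: "transitive_on (\<Omega> - {\<omega>}) (S m)"
    using subn \<phi>\<Omega>[OF e0(1)] by (simp add: \<omega>_def)
  have "forward x y = sphere y 1 - {q 1}" using forward_eq q1 xy by blast
  with w have ws: "w \<in> sphere y 1" "w \<noteq> q 1" "w' \<in> sphere y 1" "w' \<noteq> q 1" by auto
  obtain e e' where e: "e \<in> ?E" "head T e = w" "e' \<in> ?E" "head T e' = w'"
    using sphere_1_arc[OF xy(2)] ws by metis
  then have "\<phi> e \<in> \<Omega> - {\<omega>}" "\<phi> e' \<in> \<Omega> - {\<omega>}"
    using ws e0 \<phi>\<Omega> \<phi>_eq unfolding \<omega>_def by auto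
  with trans obtain g where g: "g \<in> K m" "\<theta> g (\<phi> e) = \<phi> e'"
    unfolding transitive_on_def S_def by blast
  have gy: "g \<in> fixator {y} H" "g \<in> aut T arev" using g(1) Ky[of m] Ha by (auto simp: fixator_def)
  have "snd g e = e'" using \<theta>_apply[OF gy(1) e(1)] g(2) \<phi>_eq outE gy(1) e by metis
  then have "fst g w = w'" using aut_ends(2)[OF gy(2), of e] e by auto
  with g(1) Km that show ?thesis by blast
qed

end


text \<open>A nontrivial element that fixes a large ball around \<open>x\<close> moves a vertex \<open>v\<close>; if \<open>v\<close> is as close to
  \<open>x\<close> as possible, then the element fixes the ball up to the neighbour \<open>y\<close> of \<open>v\<close> towards \<open>x\<close> and
  acts nontrivially on the neighbours of \<open>y\<close>.\<close>

lemma (in regular_tree) large_transitive_fixator: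
  assumes H: "subgroup H Aut" and F: "subgroup F (BijGroup \<Omega>)"
    and nd: "perm_topology T H \<noteq> discrete_topology H"
    and lpi: "locally_perm_isomorphic T H \<Omega> F"
    and subn: "\<And>\<omega> N. \<omega> \<in> \<Omega> \<Longrightarrow> subnormal N (BijGroup \<Omega> \<lparr>carrier := point_stab F \<omega>\<rparr>) \<Longrightarrow>
           N \<noteq> {\<one>\<^bsub>BijGroup \<Omega>\<^esub>} \<Longrightarrow> transitive_on (\<Omega> - {\<omega>}) N"
  obtains x y where "x \<in> V" "y \<in> V" "D x y \<ge> n"
    "\<And>w w'. w \<in> forward x y \<Longrightarrow> w' \<in> forward x y \<Longrightarrow> \<exists>g \<in> fixator (ball x (D x y)) H. fst g w = w'"
proof -
  have Ha: "H \<subseteq> aut T arev" using H subgroup_aut by auto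
  obtain x where x: "x \<in> V" using vertex_exists by auto
  obtain h where h: "h \<in> fixator (ball x (Suc n)) H" "h \<noteq> \<one>\<^bsub>Aut\<^esub>"
    using nondiscrete_fixator[OF H nd x] by blast
  have ha: "h \<in> aut T arev" "h \<in> H" using h Ha by (auto simp: fixator_def)
  have "\<exists>v. v \<in> V \<and> fst h v \<noteq> v"
  proof (rule ccontr)
    assume "\<not> ?thesis"
    then have "h = \<one>\<^bsub>Aut\<^esub>"
      using ha H subgroup.one_closed Ha by (intro aut_eqI) auto
    with h show False by simp
  qed
  then obtain v where v: "v \<in> V" "fst h v \<noteq> v"
    and least: "\<And>u. u \<in> V \<Longrightarrow> fst h u \<noteq> u \<Longrightarrow> D x v \<le> D x u"
    using exists_least_iff[of "\<lambda>m. \<exists>v. v \<in> V \<and> fst h v \<noteq> v \<and> D x v = m"] by (metis not_less)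
  have "v \<notin> ball x (Suc n)" using h(1) v by (auto simp: fixator_def)
  then obtain m where m: "D x v = Suc m" "m \<ge> Suc n"
    using v by (cases "D x v") (auto simp: ball_def)
  obtain y where y: "y \<in> V" "D x y = m" "D y v = 1" using pred_exists m x v by metis
  have hm: "h \<in> fixator (ball x m) H"
    unfolding fixator_def
  proof (intro CollectI conjI ballI)
    fix w assume "w \<in> ball x m"
    then have "w \<in> V" "\<not> D x v \<le> D x w" using m by (auto simp: ball_def)
    with least show "fst h w = w" by blast
  qed (rule ha)
  have vs: "v \<in> sphere y 1" and m1: "m \<ge> 1" using y v m by (simp_all add: sphere_def)
  have "\<exists>g \<in> fixator (ball x (D x y)) H. fst g w = w'" if w: "w \<in> forward x y" "w' \<in> forward x y" for w w'
  proof -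
    obtain g where "g \<in> fixator (ball x m) H" "fst g w = w'"
      by (rule fixator_transitive_on_forward[OF H F lpi subn x y(1,2) m1 hm vs v(2) w])
    then show ?thesis using y(2) by blast
  qed
  moreover have "n \<le> D x y" using m y by simp
  ultimately show ?thesis using that[of x y] x y(1) by blast
qed

text \<open>What the assumptions on the local action and the topology contribute to the comparison of the
  closures. The last condition only concerns some pair \<open>x\<close>, \<open>y\<close> at each scale; transitivity on
  pairs of vertices at a given distance, derived below, extends it to all pairs.\<close>

locale transitive_group = regular_tree T arev d
  for T :: "('v, 'e) pre_digraph" and arev :: "'e \<Rightarrow> 'e" and d :: nat +
  fixes H :: "(('v \<Rightarrow> 'v) \<times> ('e \<Rightarrow> 'e)) set"
  assumes subgroup_H: "subgroup H Aut"
    and local_trans: "\<And>x u w. x \<in> V \<Longrightarrow> u \<in> sphere x 1 \<Longrightarrow> w \<in> sphere x 1 \<Longrightarrow>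
      \<exists>h \<in> H. fst h x = x \<and> fst h u = w"
    and inversion: "\<exists>h \<in> H. \<exists>e \<in> arcs T. snd h e = arev e"
    and large_fixator: "\<And>n. \<exists>x \<in> V. \<exists>y \<in> V. D x y \<ge> n \<and>
      (\<forall>w \<in> forward x y. \<forall>w' \<in> forward x y. \<exists>g \<in> fixator (ball x (D x y)) H. fst g w = w')"
begin

lemma H_aut: "H \<subseteq> aut T arev"
  using subgroup_H subgroup_aut by auto

lemma H_mult: "g \<in> H \<Longrightarrow> h \<in> H \<Longrightarrow> g \<otimes>\<^bsub>Aut\<^esub> h \<in> H"
  and H_inv: "g \<in> H \<Longrightarrow> inv\<^bsub>Aut\<^esub> g \<in> H"
  using subgroup_H subgroup.m_closed subgroup.m_inv_closed by metis+

text \<open>The local transitivity moves vertices by even distances only; the inversion joins the two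
  classes.\<close>

lemma vertex_transitive:
  assumes "u \<in> V" "v \<in> V"
  obtains h where "h \<in> H" "fst h u = v"
proof -
  obtain i e where i: "i \<in> H" "e \<in> arcs T" "snd i e = arev e" using inversion by blast
  have ia: "i \<in> aut T arev" using i H_aut by auto
  define a b where "a = tail T e" and "b = head T e"
  have ab: "a \<in> V" "b \<in> V" "D a b = 1" using i D_arc by (auto simp: a_def b_def)
  have ib: "fst i a = b" using aut_ends(1)[OF ia i(2)] i by (simp add: a_def b_def)
  have orbit: "\<exists>h \<in> H. fst h a = w" if "w \<in> V" for w
    using that
  proof (induction "D a w" arbitrary: w)
    case 0
    then have "w = a" using D_eq_0 ab by auto
    moreover have "\<one>\<^bsub>Aut\<^esub> \<in> H" using subgroup_H subgroup.one_closed by auto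
    ultimately show ?case using ab aut_one(1) by blast
  next
    case (Suc n)
    then obtain z where z: "z \<in> V" "D a z = n" "D z w = 1" using pred_exists ab by metis
    then obtain h where h: "h \<in> H" "fst h a = z" using Suc by blast
    have ha: "h \<in> aut T arev" using h H_aut by auto
    have "fst h b \<in> sphere z 1" using aut_D[OF ha ab(1,2)] h ha ab by (simp add: sphere_def)
    moreover have "w \<in> sphere z 1" using z Suc.prems by (simp add: sphere_def)
    ultimately obtain g where g: "g \<in> H" "fst g (fst h b) = w" using local_trans z(1) by blast
    have ga: "g \<in> aut T arev" using g H_aut by auto
    have "fst (g \<otimes>\<^bsub>Aut\<^esub> h \<otimes>\<^bsub>Aut\<^esub> i) a = w" using ga ha ia ab ib g by simp
    then show ?case using H_mult g(1) h(1) i(1) by blast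
  qed
  obtain g h where gh: "g \<in> H" "fst g a = u" "h \<in> H" "fst h a = v" using orbit assms by metis
  have "g \<in> aut T arev" "h \<in> aut T arev" using gh H_aut by auto
  then have "fst (h \<otimes>\<^bsub>Aut\<^esub> inv\<^bsub>Aut\<^esub> g) u = v" using aut_inv_eq[of g a u] gh ab assms by simp
  then show ?thesis using that H_mult H_inv gh by blast
qed

definition distance_transitive :: "nat \<Rightarrow> bool" where
  "distance_transitive n \<longleftrightarrow> (\<forall>x \<in> V. \<forall>y \<in> V. \<forall>x' \<in> V. \<forall>y' \<in> V.
     D x y = n \<longrightarrow> D x' y' = n \<longrightarrow> (\<exists>h \<in> H. fst h x = x' \<and> fst h y = y'))"

lemma aut_forward:
  assumes "g \<in> aut T arev" "x \<in> V" "y \<in> V" "w \<in> forward x y"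
  shows "fst g w \<in> forward (fst g x) (fst g y)"
  using assms by (auto simp: forward_def)

text \<open>By transitivity the geodesic from \<open>x\<close> to \<open>y\<close> can be moved to the end of a much longer one,
  from \<open>x0\<close> to \<open>y\<close>, for which even the fixator of a large ball around \<open>x0\<close> permutes the
  prolongations transitively. The prolongations of both geodesics are the same.\<close>

lemma forward_transitive:
  assumes n: "distance_transitive n" "n \<ge> 1"
    and xy: "x \<in> V" "y \<in> V" "D x y = n" and w: "w \<in> forward x y" "w' \<in> forward x y"
  obtains x0 m g where "x0 \<in> V" "m \<ge> r" "g \<in> fixator (ball x0 m) H"
    "fst g x = x" "fst g y = y" "fst g w = w'"
proof -
  obtain x0 y0 where 0: "x0 \<in> V" "y0 \<in> V" "D x0 y0 \<ge> max n r"
    and tr: "\<forall>w \<in> forward x0 y0. \<forall>w' \<in> forward x0 y0. \<exists>g \<in> fixator (ball x0 (D x0 y0)) H. fst g w = w'"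
    using large_fixator[of "max n r"] by blast
  let ?m = "D x0 y0"
  obtain z0 where z0: "z0 \<in> V" "D x0 z0 = ?m - n" "D z0 y0 = n"
    using geodesic_point[OF 0(1,2) refl, of n] 0(3) by auto
  obtain n' where n': "n = Suc n'" using n(2) by (cases n) auto
  obtain b where b: "b \<in> V" "D z0 b = n'" "D b y0 = 1" using pred_exists z0 0 n' by metis
  have "D x0 b \<le> ?m - n + n'" using D_triangle[of x0 z0 b] 0 z0 b by simp
  moreover have "?m \<le> D x0 b + 1" using D_triangle[of x0 b y0] 0 b by simp
  moreover have "n \<le> ?m" using 0(3) by simp
  ultimately have "?m = Suc (D x0 b)" using n' by linarith
  moreover have b': "D y0 b = 1" using b 0 D_commute by metis
  ultimately have "forward x0 y0 = sphere y0 1 - {b}" using forward_eq 0 b by blast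
  moreover have "forward z0 y0 = sphere y0 1 - {b}" using forward_eq[OF z0(1) 0(2) b(1) b'] z0 b n' by simp
  ultimately have forward: "forward x0 y0 = forward z0 y0" by simp
  obtain h where h: "h \<in> H" "fst h z0 = x" "fst h y0 = y"
    using n(1) z0 0 xy unfolding distance_transitive_def by metis
  have ha: "h \<in> aut T arev" using h H_aut by auto
  have hx: "fst (inv\<^bsub>Aut\<^esub> h) x = z0" "fst (inv\<^bsub>Aut\<^esub> h) y = y0"
    using aut_inv_eq ha h z0 0 xy by auto
  have wV: "w \<in> V" "w' \<in> V" using w by (auto simp: forward_def)
  have "fst (inv\<^bsub>Aut\<^esub> h) w \<in> forward x0 y0" "fst (inv\<^bsub>Aut\<^esub> h) w' \<in> forward x0 y0"
    unfolding forward using aut_forward[of "inv\<^bsub>Aut\<^esub> h" x y] hx ha xy w by auto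
  then obtain g where g: "g \<in> fixator (ball x0 ?m) H"
    "fst g (fst (inv\<^bsub>Aut\<^esub> h) w) = fst (inv\<^bsub>Aut\<^esub> h) w'" using tr by blast
  have ga: "g \<in> aut T arev" using g H_aut by (auto simp: fixator_def)
  let ?g = "h \<otimes>\<^bsub>Aut\<^esub> g \<otimes>\<^bsub>Aut\<^esub> inv\<^bsub>Aut\<^esub> h"
  have "?g \<in> fixator (ball (fst h x0) ?m) H"
    using fixator_conj[OF subgroup_H h(1) g(1) ball_V] aut_ball ha 0 by metis
  moreover have "fst g z0 = z0" "fst g y0 = y0"
    using g(1) z0 0 by (auto simp: fixator_def ball_def)
  then have "fst ?g x = x" "fst ?g y = y" "fst ?g w = w'"
    using ga ha xy wV hx h g(2) z0(1) 0(2) by simp_all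
  ultimately show ?thesis using that[of "fst h x0" ?m ?g] 0 ha by auto
qed

lemma all_distance_transitive: "distance_transitive n"
proof (induction n)
  case 0
  have "\<exists>h \<in> H. fst h x = x' \<and> fst h y = y'"
    if "x \<in> V" "y \<in> V" "x' \<in> V" "y' \<in> V" "D x y = 0" "D x' y' = 0" for x y x' y'
    using that vertex_transitive[of x x'] D_eq_0 by metis
  then show ?case unfolding distance_transitive_def by blast
next
  case (Suc n)
  have "\<exists>h \<in> H. fst h x = x' \<and> fst h y = y'"
    if V: "x \<in> V" "y \<in> V" "x' \<in> V" "y' \<in> V" and D: "D x y = Suc n" "D x' y' = Suc n" for x y x' y'
  proof -
    obtain z where z: "z \<in> V" "D x z = n" "D z y = 1" using pred_exists V D by metis
    obtain z' where z': "z' \<in> V" "D x' z' = n" "D z' y' = 1" using pred_exists V D by metis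
    obtain h where h: "h \<in> H" "fst h x = x'" "fst h z = z'"
      using Suc V z z' unfolding distance_transitive_def by metis
    have ha: "h \<in> aut T arev" using h H_aut by auto
    have "y \<in> forward x z" "y' \<in> forward x' z'" using V D z z' by (auto simp: forward_def)
    then have f: "fst h y \<in> forward x' z'" "y' \<in> forward x' z'" using aut_forward[OF ha V(1) z(1)] h by auto
    have "\<exists>g \<in> H. fst g x' = x' \<and> fst g (fst h y) = y'"
    proof (cases "n = 0")
      case True
      then have "z' = x'" using z' V D_eq_0 by auto
      then show ?thesis using local_trans[OF V(3)] f forward_self[OF V(3)] by auto
    next
      case False
      then have "n \<ge> 1" by simp
      obtain x0 m g where "g \<in> fixator (ball x0 m) H" "fst g x' = x'" "fst g (fst h y) = y'"
        using forward_transitive[OF Suc.IH \<open>n \<ge> 1\<close> V(3) z'(1,2) f] by metis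
      then show ?thesis by (auto simp: fixator_def)
    qed
    then obtain g where g: "g \<in> H" "fst g x' = x'" "fst g (fst h y) = y'" by blast
    have "g \<in> aut T arev" using g H_aut by auto
    then have "fst (g \<otimes>\<^bsub>Aut\<^esub> h) x = x'" "fst (g \<otimes>\<^bsub>Aut\<^esub> h) y = y'" using ha V g h by auto
    then show ?thesis using H_mult g h by blast
  qed
  then show ?case unfolding distance_transitive_def by blast
qed

end

section \<open>The groups generated by edge-neighbourhood fixators\<close>

context regular_tree
begin

definition type_preserving :: "(('v \<Rightarrow> 'v) \<times> ('e \<Rightarrow> 'e)) set \<Rightarrow> bool" where
  "type_preserving G \<longleftrightarrow> (\<forall>g \<in> G. \<forall>v \<in> V. even (D v (fst g v)))"

definition sphere_transitive :: "(('v \<Rightarrow> 'v) \<times> ('e \<Rightarrow> 'e)) set \<Rightarrow> bool" where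
  "sphere_transitive G \<longleftrightarrow> (\<forall>x \<in> V. \<forall>u \<in> V. \<forall>w \<in> V. D x u = D x w \<longrightarrow>
     (\<exists>g \<in> G. fst g x = x \<and> fst g u = w))"

abbreviation Plus where "Plus \<equiv> plus_k T arev"

lemma plus_eq:
  assumes "G \<subseteq> aut T arev"
  shows "Plus k G = generate Aut (\<Union>e \<in> arcs T. fixator (nbhd e (k - 1)) G)"
  unfolding plus_k_def using pointwise_stab_nbhd[OF assms] by simp

lemma plus_subgroup:
  assumes "G \<subseteq> aut T arev"
  shows "subgroup (Plus k G) Aut"
  unfolding plus_eq[OF assms]
  by (rule group.generate_is_subgroup[OF group_Aut]) (use assms in \<open>auto simp: fixator_def\<close>)

lemma plus_subset:
  assumes "subgroup G Aut"
  shows "Plus k G \<subseteq> G"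
  unfolding plus_eq[OF subgroup_aut[OF assms]]
  by (rule group.generate_subgroup_incl[OF group_Aut _ assms]) (auto simp: fixator_def)

lemma fixator_subset_plus:
  assumes "G \<subseteq> aut T arev" "e \<in> arcs T"
  shows "fixator (nbhd e (k - 1)) G \<subseteq> Plus k G"
  unfolding plus_eq[OF assms(1)] using assms(2) by (auto intro: generate.incl)

lemma fixator_plus:
  assumes "subgroup G Aut" "e \<in> arcs T" "k - 1 \<le> n"
  shows "fixator (nbhd e n) (Plus k G) = fixator (nbhd e n) G"
  using plus_subset[OF assms(1), of k] fixator_subset_plus[OF subgroup_aut[OF assms(1)] assms(2), of k]
    nbhd_mono[OF assms(3), of e] by (auto simp: fixator_def)

text \<open>A generator fixes a vertex, so it moves every vertex by an even distance.\<close>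

lemma type_preserving_plus:
  assumes "G \<subseteq> aut T arev"
  shows "type_preserving (Plus k G)"
proof -
  have "g \<in> aut T arev \<and> (\<forall>v \<in> V. even (D v (fst g v)))" if "g \<in> Plus k G" for g
    using that unfolding plus_eq[OF assms]
  proof induction
    case one
    then show ?case using group.is_monoid[OF group_Aut] monoid.one_closed by fastforce
  next
    case (incl h)
    then obtain e where e: "e \<in> arcs T" "h \<in> fixator (nbhd e (k - 1)) G" by blast
    then have h: "h \<in> aut T arev" "fst h (tail T e) = tail T e"
      using assms nbhd_ends by (auto simp: fixator_def)
    have "even (D v (fst h v))" if v: "v \<in> V" for v
      using even_D_triangle[of v "tail T e" "fst h v"] aut_D[OF h(1) v, of "tail T e"]
        D_commute[of v "tail T e"] D_commute[of "fst h v" "tail T e"] v e h by auto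
    with h show ?case by blast
  next
    case (inv h)
    then obtain e where e: "e \<in> arcs T" "h \<in> fixator (nbhd e (k - 1)) G" by blast
    then have h: "h \<in> aut T arev" "fst h (tail T e) = tail T e"
      using assms nbhd_ends by (auto simp: fixator_def)
    then have h': "inv\<^bsub>Aut\<^esub> h \<in> aut T arev" "fst (inv\<^bsub>Aut\<^esub> h) (tail T e) = tail T e"
      using e aut_inv_eq by auto
    have "even (D v (fst (inv\<^bsub>Aut\<^esub> h) v))" if v: "v \<in> V" for v
      using even_D_triangle[of v "tail T e" "fst (inv\<^bsub>Aut\<^esub> h) v"] aut_D[OF h'(1) v, of "tail T e"]
        D_commute[of v "tail T e"] D_commute[of "fst (inv\<^bsub>Aut\<^esub> h) v" "tail T e"] v e h' by auto
    with h' show ?case by blast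
  next
    case (eng g h)
    have "even (D v (fst (g \<otimes>\<^bsub>Aut\<^esub> h) v))" if v: "v \<in> V" for v
    proof -
      have "even (D v (fst h v))" "even (D (fst h v) (fst g (fst h v)))" using eng.IH v by auto
      then show ?thesis
        using even_D_triangle[of v "fst h v" "fst g (fst h v)"] eng.IH v by auto
    qed
    with eng.IH show ?case by simp
  qed
  then show ?thesis by (auto simp: type_preserving_def)
qed

end

text \<open>The fixators of balls of radius at least \<open>k\<close> belong to the generated group, so they provide its
  transitivity on prolongations of geodesics. Spheres follow by induction on the radius.\<close>

lemma (in transitive_group) sphere_transitive_plus:
  assumes k: "k \<ge> 1" and d: "d \<ge> 3"
  shows "sphere_transitive (Plus k (Pk k H))"
proof -
  let ?G = "Pk k H" and ?A = "Plus k (Pk k H)"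
  have Aa: "?A \<subseteq> aut T arev" using plus_subgroup[OF Pk_aut] subgroup_aut by auto
  have mult: "g \<otimes>\<^bsub>Aut\<^esub> h \<in> ?A" if "g \<in> ?A" "h \<in> ?A" for g h
    using that subgroup.m_closed[OF plus_subgroup[OF Pk_aut]] by auto
  have fixA: "g \<in> ?A" if g: "g \<in> fixator (ball x0 m) H" "x0 \<in> V" "m \<ge> k" for g x0 m
  proof -
    have "card (out_arcs T x0) > 0" using regular[OF g(2)] d by auto
    then obtain e where e: "e \<in> arcs T" "tail T e = x0"
      by (metis card_gt_0_iff ex_in_conv in_out_arcs_conv)
    have "nbhd e (k - 1) \<subseteq> ball x0 m"
      using nbhd_subset_ball[OF e(1), of "k - 1"] e(2) k g(3) by (auto simp: ball_def)
    then have "g \<in> fixator (nbhd e (k - 1)) ?G"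
      using g(1) Pk_superset[OF H_aut] by (auto simp: fixator_def)
    then show ?thesis using fixator_subset_plus[OF Pk_aut e(1)] by blast
  qed
  have forwardA: "\<exists>g \<in> ?A. fst g x = x \<and> fst g y = y \<and> fst g w = w'"
    if xy: "x \<in> V" "y \<in> V" "x \<noteq> y" "w \<in> forward x y" "w' \<in> forward x y" for x y w w'
  proof -
    have "D x y \<ge> 1" using xy D_eq_0[of x y] by simp
    from forward_transitive[OF all_distance_transitive this xy(1,2) refl xy(4,5), of k]
    show ?thesis using fixA by metis
  qed
  have "\<exists>g \<in> ?A. fst g x = x \<and> fst g u = w"
    if "x \<in> V" "u \<in> V" "w \<in> V" "D x u = n" "D x w = n" for x u w n
    using that
  proof (induction n arbitrary: u w)
    case 0
    then have "u = x" "w = x" using D_eq_0 by auto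
    moreover have "\<one>\<^bsub>Aut\<^esub> \<in> ?A" using subgroup.one_closed[OF plus_subgroup[OF Pk_aut]] .
    ultimately show ?case using 0 aut_one(1) by blast
  next
    case (Suc n)
    show ?case
    proof (cases "n = 0")
      case True
      \<comment> \<open>Seen from a third neighbour \<open>z\<close> of \<open>x\<close>, both \<open>u\<close> and \<open>w\<close> prolong the edge from \<open>z\<close> to \<open>x\<close>.\<close>
      have "card {u, w} \<le> 2" by (simp add: card_insert_if)
      then have "card (sphere x 1 - {u, w}) > 0"
        using diff_card_le_card_Diff[of "{u, w}" "sphere x 1"] sphere_1[of x] Suc.prems d by simp
      then obtain z where "z \<in> sphere x 1 - {u, w}" by (metis card_gt_0_iff ex_in_conv)
      then have z: "z \<in> V" "D x z = 1" "z \<noteq> u" "z \<noteq> w" by (auto simp: sphere_def)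
      then have zx: "z \<noteq> x" "D z x = Suc (D z z)" using Suc.prems D_commute by auto
      then have "forward z x = sphere x 1 - {z}" using forward_eq[of z x z] z Suc.prems by auto
      then have "u \<in> forward z x" "w \<in> forward z x" using z Suc.prems True by (auto simp: sphere_def)
      then show ?thesis using forwardA[of z x u w] z zx Suc.prems by blast
    next
      case False
      obtain y where y: "y \<in> V" "D x y = n" "D y u = 1" using pred_exists Suc.prems by metis
      obtain y' where y': "y' \<in> V" "D x y' = n" "D y' w = 1" using pred_exists Suc.prems by metis
      obtain h where h: "h \<in> ?A" "fst h x = x" "fst h y = y'" using Suc.IH y y' Suc.prems by blast
      have ha: "h \<in> aut T arev" using h Aa by auto
      have "u \<in> forward x y" "w \<in> forward x y'" using y y' Suc.prems by (auto simp: forward_def)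
      then have "fst h u \<in> forward x y'" "w \<in> forward x y'" using aut_forward[OF ha, of x y u] Suc.prems y h by auto
      moreover have "x \<noteq> y'" using False y' Suc.prems by auto
      ultimately obtain g where g: "g \<in> ?A" "fst g x = x" "fst g (fst h u) = w"
        using forwardA[of x y'] y' Suc.prems by blast
      have ga: "g \<in> aut T arev" using g Aa by auto
      have "fst (g \<otimes>\<^bsub>Aut\<^esub> h) x = x" "fst (g \<otimes>\<^bsub>Aut\<^esub> h) u = w"
        using ga ha g h Suc.prems by auto
      then show ?thesis using mult g h by blast
    qed
  qed
  then show ?thesis unfolding sphere_transitive_def by blast
qed


section \<open>Isomorphisms are induced by isometries\<close>

lemma finite_image_factor:
  assumes "finite (f ` S)" and "\<And>a b. a \<in> S \<Longrightarrow> b \<in> S \<Longrightarrow> f a = f b \<Longrightarrow> h a = h b"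
  shows "finite (h ` S)"
proof -
  have "h ` S \<subseteq> (\<lambda>t. h (inv_into S f t)) ` (f ` S)"
  proof
    fix t assume "t \<in> h ` S"
    then obtain a where a: "a \<in> S" "t = h a" by auto
    then have "f (inv_into S f (f a)) = f a" "inv_into S f (f a) \<in> S"
      by (auto intro: f_inv_into_f inv_into_into)
    then have "t = h (inv_into S f (f a))" using assms(2) a by metis
    then show "t \<in> (\<lambda>t. h (inv_into S f t)) ` (f ` S)" using a(1) by blast
  qed
  then show ?thesis using assms(1) by (meson finite_imageI finite_subset)
qed

lemma homeomorphic_map_inv_into:
  assumes "homeomorphic_map X Y f"
  shows "homeomorphic_map Y X (inv_into (topspace X) f)"
proof -
  obtain g where "homeomorphic_maps X Y f g"
    using assms unfolding homeomorphic_map_maps by blast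
  then have g: "homeomorphic_map Y X g" "\<forall>y \<in> topspace Y. f (g y) = y"
    unfolding homeomorphic_maps_map by blast+
  show ?thesis
  proof (rule homeomorphic_map_eq[OF g(1)])
    fix y assume y: "y \<in> topspace Y"
    then have "g y \<in> topspace X" using homeomorphic_imp_surjective_map[OF g(1)] by blast
    then have "inv_into (topspace X) f (f (g y)) = g y"
      using homeomorphic_imp_injective_map[OF assms] by (rule inv_into_f_f[rotated])
    then show "g y = inv_into (topspace X) f y" using g(2) y by simp
  qed
qed

lemma top_group_isomorphic_sym:
  assumes "top_group_isomorphic G X K Y" "group G" "topspace X = carrier G"
  shows "top_group_isomorphic K Y G X"
  using assms group.iso_set_sym homeomorphic_map_inv_into
  unfolding top_group_isomorphic_def by metis

context regular_tree
begin

text \<open>The vertices that minimise the largest distance to a finite invariant set form an invariant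
  set of diameter at most one, by convexity. A type-preserving automorphism moves vertices by even
  distances, hence fixes them all.\<close>

lemma finite_orbit_fixed_vertex:
  assumes L: "L \<subseteq> aut T arev" "type_preserving L"
    and S: "finite S" "S \<noteq> {}" "S \<subseteq> V" "\<And>g. g \<in> L \<Longrightarrow> fst g ` S = S"
  obtains v where "v \<in> V" "\<And>g. g \<in> L \<Longrightarrow> fst g v = v"
proof -
  define r where "r v = Max ((\<lambda>z. D z v) ` S)" for v
  have inv: "r (fst g v) = r v" if g: "g \<in> L" and v: "v \<in> V" for g v
  proof -
    have ga: "g \<in> aut T arev" using g L(1) by blast
    have "(\<lambda>z. D z (fst g v)) ` S = (\<lambda>z. D z (fst g v)) ` (fst g ` S)" using S(4)[OF g] by simp
    also have "\<dots> = (\<lambda>z. D z v) ` S"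
      unfolding image_image using S(3) aut_D[OF ga _ v] by (intro image_cong) auto
    finally show ?thesis by (simp add: r_def)
  qed
  obtain v where v: "v \<in> V" and min: "\<And>u. u \<in> V \<Longrightarrow> r v \<le> r u"
    using arg_min_natI[of "\<lambda>v. v \<in> V" _ r] arg_min_nat_le[of "\<lambda>v. v \<in> V" _ r] vertex_exists
    by blast
  have "fst g v = v" if g: "g \<in> L" for g
  proof (rule ccontr)
    assume ne: "fst g v \<noteq> v"
    have gv: "fst g v \<in> V" using g L(1) v by auto
    then have "D v (fst g v) \<noteq> 0" using ne v D_eq_0 by auto
    moreover have "even (D v (fst g v))" using L(2) g v by (auto simp: type_preserving_def)
    ultimately have "D v (fst g v) \<ge> 2" by (cases "D v (fst g v) = 1") auto
    then obtain u where u: "u \<in> V" "\<And>z. z \<in> V \<Longrightarrow> D z u < max (D z v) (D z (fst g v))"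
      using interior_point v gv by blast
    have "r u \<in> (\<lambda>z. D z u) ` S" unfolding r_def using S(1,2) by (intro Max_in) auto
    then obtain z where z: "z \<in> S" "r u = D z u" by blast
    have "D z v \<le> r v" "D z (fst g v) \<le> r (fst g v)" unfolding r_def using z S(1) by auto
    then have "r u < r v" using u(2)[of z] z S(3) inv[OF g v] by auto
    then show False using min[OF u(1)] by simp
  qed
  with v that show ?thesis by blast
qed

lemma finite_restrictions:
  assumes "C \<subseteq> V" "finite C" "x \<in> V" "A \<subseteq> aut T arev" "\<And>g. g \<in> A \<Longrightarrow> fst g x = x"
  shows "finite ((\<lambda>g. restrict (fst g) C) ` A)"
proof (rule finite_subset)
  show "(\<lambda>g. restrict (fst g) C) ` A \<subseteq> PiE C (\<lambda>v. sphere x (D x v))"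
  proof (intro image_subsetI PiE_I)
    fix g v assume g: "g \<in> A" and v: "v \<in> C"
    then have "g \<in> aut T arev" "v \<in> V" using assms by auto
    then show "restrict (fst g) C v \<in> sphere x (D x v)"
      using aut_D[of g x v] assms(3) assms(5)[OF g] v by (simp add: sphere_def)
  qed simp
  show "finite (PiE C (\<lambda>v. sphere x (D x v)))"
    using assms finite_sphere by (intro finite_PiE) auto
qed

text \<open>A vertex stabiliser in \<open>B\<close> is open, so its preimage contains the fixator of a finite set of
  vertices. In the stabiliser of \<open>x\<close> this fixator has finite index, since spheres are finite.
  Therefore the image of the stabiliser of \<open>x\<close> has a finite orbit.\<close>

lemma stabiliser_image_fixes_vertex:
  assumes A: "subgroup A Aut" and B: "subgroup B Aut" "type_preserving B"
    and hom: "\<phi> \<in> hom (Aut\<lparr>carrier := A\<rparr>) (Aut\<lparr>carrier := B\<rparr>)"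
    and cont: "continuous_map (perm_topology T A) (perm_topology T B) \<phi>"
    and x: "x \<in> V"
  obtains y where "y \<in> V" "\<phi> ` fixator {x} A \<subseteq> fixator {y} B"
proof -
  have Aa: "A \<subseteq> aut T arev" and Ba: "B \<subseteq> aut T arev" using A B subgroup_aut by auto
  have \<phi>B: "\<phi> g \<in> B" if "g \<in> A" for g using hom that by (auto simp: hom_def)
  have mult: "\<phi> (g \<otimes>\<^bsub>Aut\<^esub> h) = \<phi> g \<otimes>\<^bsub>Aut\<^esub> \<phi> h" if "g \<in> A" "h \<in> A" for g h
    using hom that by (auto simp: hom_def)
  let ?L = "fixator {x} A"
  have L: "subgroup ?L Aut" using fixator_subgroup A x by auto
  have LA: "?L \<subseteq> A" by (auto simp: fixator_def)
  \<comment> \<open>Any vertex would do as the base point of the orbit in the target; \<open>x\<close> is at hand.\<close>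
  define U where "U = {g \<in> A. fst (\<phi> g) x = x}"
  have "openin (perm_topology T A) {g \<in> topspace (perm_topology T A). \<phi> g \<in> {h \<in> B. \<forall>v \<in> {x}. fst h v = v}}"
    by (rule openin_continuous_map_preimage[OF cont openin_perm_topology_agree]) (use x in auto)
  moreover have "{g \<in> topspace (perm_topology T A). \<phi> g \<in> {h \<in> B. \<forall>v \<in> {x}. fst h v = v}} = U"
    using \<phi>B by (auto simp: U_def)
  ultimately have open_U: "openin (perm_topology T A) U" by simp
  have one: "\<one>\<^bsub>Aut\<^esub> \<in> A" using A by (rule subgroup.one_closed)
  have "\<phi> \<one>\<^bsub>Aut\<^esub> = \<one>\<^bsub>Aut\<^esub>"
    using hom_one[OF hom] group.subgroup_imp_group[OF group_Aut] A B by simp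
  then have "\<one>\<^bsub>Aut\<^esub> \<in> U" using one x by (simp add: U_def)
  from perm_topology_neighbourhood[OF open_U this Aa]
  obtain C where C: "finite C" "C \<subseteq> V" "{h \<in> A. \<forall>v \<in> C. fst h v = fst \<one>\<^bsub>Aut\<^esub> v} \<subseteq> U"
    by (elim exE conjE)
  have CU: "h \<in> U" if h: "h \<in> A" "\<And>v. v \<in> C \<Longrightarrow> fst h v = v" for h
  proof -
    have "h \<in> {h \<in> A. \<forall>v \<in> C. fst h v = fst \<one>\<^bsub>Aut\<^esub> v}" using h C(2) by (auto simp: subset_iff)
    then show ?thesis using C(3) by blast
  qed
  define S where "S = (\<lambda>g. fst (\<phi> g) x) ` ?L"
  have "finite S"
    unfolding S_def
  proof (rule finite_image_factor)
    show "finite ((\<lambda>g. restrict (fst g) C) ` ?L)"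
      by (rule finite_restrictions[OF C(2,1) x]) (use Aa in \<open>auto simp: fixator_def\<close>)
    fix g h assume gh: "g \<in> ?L" "h \<in> ?L" "restrict (fst g) C = restrict (fst h) C"
    then have ghA: "g \<in> A" "h \<in> A" "g \<in> aut T arev" "h \<in> aut T arev" using LA Aa by auto
    let ?k = "inv\<^bsub>Aut\<^esub> g \<otimes>\<^bsub>Aut\<^esub> h"
    have kA: "?k \<in> A" using ghA subgroup.m_closed[OF A] subgroup.m_inv_closed[OF A] by auto
    have "fst ?k v = v" if v: "v \<in> C" for v
    proof -
      have "fst g v = fst h v" using gh(3) v by (metis restrict_apply')
      moreover have "v \<in> V" using v C(2) by auto
      ultimately show ?thesis using ghA aut_inv(1)[of g v] by simp
    qed
    then have "?k \<in> U" using CU kA by blast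
    then have "fst (\<phi> ?k) x = x" by (simp add: U_def)
    moreover have "g \<otimes>\<^bsub>Aut\<^esub> ?k = h" by (rule aut_eqI) (use ghA in auto)
    then have "\<phi> h = \<phi> g \<otimes>\<^bsub>Aut\<^esub> \<phi> ?k" using mult[OF ghA(1) kA] by simp
    moreover have "\<phi> g \<in> aut T arev" "\<phi> ?k \<in> aut T arev"
      using \<phi>B[OF ghA(1)] \<phi>B[OF kA] Ba by blast+
    ultimately show "fst (\<phi> g) x = fst (\<phi> h) x" using x by simp
  qed
  moreover have "S \<noteq> {}" using subgroup.one_closed[OF L] by (auto simp: S_def)
  moreover have SV: "S \<subseteq> V"
  proof
    fix z assume "z \<in> S"
    then obtain g where "g \<in> ?L" "z = fst (\<phi> g) x" by (auto simp: S_def)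
    moreover have "\<phi> g \<in> aut T arev" if "g \<in> ?L" using that LA \<phi>B Ba by blast
    ultimately show "z \<in> V" using x by simp
  qed
  moreover have "fst h ` S = S" if h: "h \<in> \<phi> ` ?L" for h
  proof -
    obtain g where g: "g \<in> ?L" "h = \<phi> g" using h by auto
    have ha: "h \<in> aut T arev" using g LA \<phi>B Ba by blast
    have "fst h ` S \<subseteq> S"
    proof
      fix z assume "z \<in> fst h ` S"
      then obtain g' where g': "g' \<in> ?L" "z = fst h (fst (\<phi> g') x)" by (auto simp: S_def)
      have "\<phi> g' \<in> aut T arev" using g' LA \<phi>B Ba by blast
      moreover have "g \<in> A" "g' \<in> A" using g g' LA by blast+
      ultimately have "z = fst (\<phi> (g \<otimes>\<^bsub>Aut\<^esub> g')) x" using mult[of g g'] g g'(2) ha x by simp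
      moreover have "g \<otimes>\<^bsub>Aut\<^esub> g' \<in> ?L" using L g g' subgroup.m_closed by metis
      ultimately show "z \<in> S" by (auto simp: S_def)
    qed
    moreover have "inj_on (fst h) S" using aut_inj[OF ha] SV by (auto simp: inj_on_def)
    ultimately show ?thesis using \<open>finite S\<close> by (simp add: endo_inj_surj)
  qed
  moreover have LB: "\<phi> ` ?L \<subseteq> B" using LA \<phi>B by blast
  then have "\<phi> ` ?L \<subseteq> aut T arev" "type_preserving (\<phi> ` ?L)"
    using Ba B(2) by (auto simp: type_preserving_def)
  ultimately obtain v where "v \<in> V" "\<And>g. g \<in> \<phi> ` ?L \<Longrightarrow> fst g v = v"
    using finite_orbit_fixed_vertex[of "\<phi> ` ?L" S] by metis
  with LB have "\<phi> ` ?L \<subseteq> fixator {v} B" unfolding fixator_def[of "{v}" B] by blast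
  with \<open>v \<in> V\<close> that show ?thesis by blast
qed

lemma card_sphere_inj:
  assumes "d \<ge> 3" "x \<in> V" "y \<in> V" "card (sphere x m) = card (sphere y n)"
  shows "m = n"
proof -
  have *: "card (sphere z (Suc j)) > 1" if "z \<in> V" for z j
  proof -
    have "(d - 1) ^ j \<ge> 1" using assms(1) by (intro one_le_power) simp
    then have "d * 1 \<le> d * (d - 1) ^ j" by (intro mult_le_mono2) simp
    then show ?thesis using card_sphere[OF that, of j] assms(1) by linarith
  qed
  have sphere0: "card (sphere z 0) = 1" if "z \<in> V" for z using sphere_0[OF that] by simp
  show ?thesis
  proof (cases m)
    case 0
    then show ?thesis using *[OF assms(3), of "n - 1"] sphere0[OF assms(2)] assms(4) by (cases n) auto
  next
    case (Suc m')
    then obtain n' where n': "n = Suc n'" using *[OF assms(2), of m'] sphere0[OF assms(3)] assms(4) by (cases n) auto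
    then have "(d - 1) ^ m' = (d - 1) ^ n'"
      using Suc assms card_sphere[OF assms(2), of m'] card_sphere[OF assms(3), of n'] by simp
    then show ?thesis using assms(1) Suc n' by (simp add: power_inject_exp)
  qed
qed

lemma stabiliser_subset_imp_eq:
  assumes "sphere_transitive G" "G \<subseteq> aut T arev" "d \<ge> 3" "x \<in> V" "y \<in> V"
    and "fixator {x} G \<subseteq> fixator {y} G"
  shows "x = y"
proof (rule ccontr)
  assume "x \<noteq> y"
  then have "D x y \<noteq> 0" using assms D_eq_0 by auto
  have "sphere x (D x y) \<noteq> {y}"
  proof
    assume "sphere x (D x y) = {y}"
    then have "card (sphere x (D x y)) = card (sphere y 0)" using sphere_0 assms(5) by simp
    then have "D x y = 0" by (rule card_sphere_inj[OF assms(3-5)])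
    with \<open>D x y \<noteq> 0\<close> show False ..
  qed
  moreover have "y \<in> sphere x (D x y)" using assms by (simp add: sphere_def)
  ultimately obtain w where w: "w \<in> V" "D x w = D x y" "w \<noteq> y" by (auto simp: sphere_def)
  then obtain g where g: "g \<in> G" "fst g x = x" "fst g y = w"
    using assms(1,4,5) unfolding sphere_transitive_def by metis
  then have "g \<in> fixator {x} G" by (simp add: fixator_def)
  then show False using assms(6) g w by (auto simp: fixator_def)
qed

text \<open>Mapping a stabiliser there and back gives \<open>fixator {x} A \<subseteq> fixator {z} A\<close> for some vertex \<open>z\<close>.
  The left-hand side is transitive on the spheres around \<open>x\<close> and so fixes no vertex but \<open>x\<close>. Hence
  \<open>z = x\<close>, and all inclusions on the way are equalities.\<close>

lemma stabiliser_image: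
  assumes A: "subgroup A Aut" "type_preserving A" "sphere_transitive A"
    and B: "subgroup B Aut" "type_preserving B" and d: "d \<ge> 3"
    and \<phi>: "\<phi> \<in> hom (Aut\<lparr>carrier := A\<rparr>) (Aut\<lparr>carrier := B\<rparr>)"
      "continuous_map (perm_topology T A) (perm_topology T B) \<phi>"
    and \<psi>: "\<psi> \<in> hom (Aut\<lparr>carrier := B\<rparr>) (Aut\<lparr>carrier := A\<rparr>)"
      "continuous_map (perm_topology T B) (perm_topology T A) \<psi>"
    and inverse: "\<And>g. g \<in> A \<Longrightarrow> \<psi> (\<phi> g) = g" "\<And>g. g \<in> B \<Longrightarrow> \<phi> (\<psi> g) = g"
    and x: "x \<in> V"
  obtains y where "y \<in> V" "\<phi> ` fixator {x} A = fixator {y} B"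
proof -
  obtain y where y: "y \<in> V" "\<phi> ` fixator {x} A \<subseteq> fixator {y} B"
    using stabiliser_image_fixes_vertex[OF A(1) B \<phi> x] by blast
  obtain z where z: "z \<in> V" "\<psi> ` fixator {y} B \<subseteq> fixator {z} A"
    using stabiliser_image_fixes_vertex[OF B(1) A(1,2) \<psi> y(1)] by blast
  have "fixator {x} A \<subseteq> fixator {z} A"
  proof
    fix g assume g: "g \<in> fixator {x} A"
    then have "\<psi> (\<phi> g) = g" using inverse(1) by (simp add: fixator_def)
    moreover have "\<psi> (\<phi> g) \<in> fixator {z} A" using g y(2) z(2) by blast
    ultimately show "g \<in> fixator {z} A" by simp
  qed
  then have "x = z" using stabiliser_subset_imp_eq A subgroup_aut d x z(1) by blast
  have "fixator {y} B \<subseteq> \<phi> ` fixator {x} A"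
  proof
    fix h assume h: "h \<in> fixator {y} B"
    then have "h = \<phi> (\<psi> h)" using inverse(2) by (simp add: fixator_def)
    moreover have "\<psi> h \<in> fixator {x} A" using h z(2) \<open>x = z\<close> by blast
    ultimately show "h \<in> \<phi> ` fixator {x} A" by blast
  qed
  with y that show ?thesis by blast
qed

text \<open>Vertices correspond to their stabilisers, which an isomorphism permutes; this defines \<open>\<alpha>\<close>, and
  equivariance expresses that conjugating a stabiliser moves its fixed vertex. Being equivariant,
  \<open>\<alpha>\<close> maps orbits of the stabiliser of \<open>x\<close>, that is, spheres around \<open>x\<close>, onto spheres around \<open>\<alpha> x\<close>,
  and the cardinality of a sphere determines its radius.\<close>

lemma topological_isomorphism_induced:
  assumes A: "subgroup A Aut" "type_preserving A" "sphere_transitive A"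
    and B: "subgroup B Aut" "type_preserving B" "sphere_transitive B" and d: "d \<ge> 3"
    and iso: "\<phi> \<in> iso (Aut\<lparr>carrier := A\<rparr>) (Aut\<lparr>carrier := B\<rparr>)"
    and homeo: "homeomorphic_map (perm_topology T A) (perm_topology T B) \<phi>"
  obtains \<alpha> where "bij_betw \<alpha> V V" "\<And>x y. x \<in> V \<Longrightarrow> y \<in> V \<Longrightarrow> D (\<alpha> x) (\<alpha> y) = D x y"
    "\<And>g x. g \<in> A \<Longrightarrow> x \<in> V \<Longrightarrow> fst (\<phi> g) (\<alpha> x) = \<alpha> (fst g x)"
proof -
  have Aa: "A \<subseteq> aut T arev" and Ba: "B \<subseteq> aut T arev" using A B subgroup_aut by auto
  define \<psi> where "\<psi> = inv_into A \<phi>"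
  have \<psi>_iso: "\<psi> \<in> iso (Aut\<lparr>carrier := B\<rparr>) (Aut\<lparr>carrier := A\<rparr>)"
    using group.iso_set_sym[OF group.subgroup_imp_group[OF group_Aut A(1)] iso] by (simp add: \<psi>_def)
  have homs: "\<phi> \<in> hom (Aut\<lparr>carrier := A\<rparr>) (Aut\<lparr>carrier := B\<rparr>)"
    "\<psi> \<in> hom (Aut\<lparr>carrier := B\<rparr>) (Aut\<lparr>carrier := A\<rparr>)"
    using iso \<psi>_iso by (auto simp: iso_def)
  have conts: "continuous_map (perm_topology T A) (perm_topology T B) \<phi>"
    "continuous_map (perm_topology T B) (perm_topology T A) \<psi>"
    using homeo homeomorphic_map_inv_into[OF homeo]
    by (simp_all add: \<psi>_def homeomorphic_imp_continuous_map)
  have bij: "bij_betw \<phi> A B" using iso by (simp add: iso_def)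
  have inv1: "\<psi> (\<phi> g) = g" if "g \<in> A" for g
    using bij that by (simp add: \<psi>_def bij_betw_def)
  have inv2: "\<phi> (\<psi> g) = g" if "g \<in> B" for g
    using bij that by (simp add: \<psi>_def bij_betw_def f_inv_into_f)
  have \<phi>B: "\<phi> g \<in> B" if "g \<in> A" for g using bij that by (auto simp: bij_betw_def)
  have mult: "\<phi> (g \<otimes>\<^bsub>Aut\<^esub> h) = \<phi> g \<otimes>\<^bsub>Aut\<^esub> \<phi> h" if "g \<in> A" "h \<in> A" for g h
    using homs(1) that by (auto simp: hom_def)
  have fixA: "fixator {z} A \<subseteq> A" and fixB: "fixator {z} B \<subseteq> B" for z by (auto simp: fixator_def)
  define \<alpha> where "\<alpha> x = (SOME y. y \<in> V \<and> \<phi> ` fixator {x} A = fixator {y} B)" for x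
  have \<alpha>: "\<alpha> x \<in> V \<and> \<phi> ` fixator {x} A = fixator {\<alpha> x} B" if x: "x \<in> V" for x
  proof -
    obtain y where "y \<in> V" "\<phi> ` fixator {x} A = fixator {y} B"
      by (rule stabiliser_image[OF A B(1,2) d homs(1) conts(1) homs(2) conts(2) _ _ x])
         (simp_all add: inv1 inv2)
    then have "y \<in> V \<and> \<phi> ` fixator {x} A = fixator {y} B" ..
    then show ?thesis unfolding \<alpha>_def by (rule someI)
  qed
  have \<alpha>_unique: "y = \<alpha> x" if "x \<in> V" "y \<in> V" "fixator {\<alpha> x} B \<subseteq> fixator {y} B" for x y
    using stabiliser_subset_imp_eq[OF B(3) Ba d _ that(2,3)] \<alpha>[OF that(1)] by auto
  have inj: "inj_on \<alpha> V"
  proof (rule inj_onI)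
    fix x x' assume x: "x \<in> V" "x' \<in> V" "\<alpha> x = \<alpha> x'"
    then have "\<phi> ` fixator {x} A = \<phi> ` fixator {x'} A" using \<alpha> by simp
    then have "fixator {x} A = fixator {x'} A"
      using inj_on_image_eq_iff[of \<phi> A] bij fixA by (simp add: bij_betw_def)
    then show "x = x'" using stabiliser_subset_imp_eq[OF A(3) Aa d] x by simp
  qed
  have "y \<in> \<alpha> ` V" if y: "y \<in> V" for y
  proof -
    obtain x where x: "x \<in> V" "\<psi> ` fixator {y} B = fixator {x} A"
      by (rule stabiliser_image[OF B A(1,2) d homs(2) conts(2) homs(1) conts(1) _ _ y])
         (simp_all add: inv1 inv2)
    have "\<phi> ` fixator {x} A = fixator {y} B"
    proof -
      have "(\<lambda>g. \<phi> (\<psi> g)) ` fixator {y} B = (\<lambda>g. g) ` fixator {y} B"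
        by (rule image_cong[OF refl], rule inv2, erule subsetD[OF fixB])
      then show ?thesis unfolding x(2)[symmetric] image_image by simp
    qed
    then have "fixator {\<alpha> x} B = fixator {y} B"
      by (rule trans[OF conjunct2[OF \<alpha>[OF x(1)], symmetric]])
    then have "y = \<alpha> x" by (intro \<alpha>_unique[OF x(1) y] equalityD1)
    with x(1) show ?thesis by blast
  qed
  with inj \<alpha> have bij\<alpha>: "bij_betw \<alpha> V V" by (auto simp: bij_betw_def)
  have equi: "fst (\<phi> g) (\<alpha> x) = \<alpha> (fst g x)" if g: "g \<in> A" and x: "x \<in> V" for g x
  proof -
    have ga: "g \<in> aut T arev" "\<phi> g \<in> aut T arev" using g Aa Ba \<phi>B by blast+
    have gx: "fst g x \<in> V" using ga x by simp
    have "fixator {\<alpha> (fst g x)} B \<subseteq> fixator {fst (\<phi> g) (\<alpha> x)} B"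
    proof
      fix h' assume "h' \<in> fixator {\<alpha> (fst g x)} B"
      then have "h' \<in> \<phi> ` fixator {fst g x} A" using \<alpha>[OF gx] by simp
      then obtain h where h: "h \<in> A" "fst h (fst g x) = fst g x" "h' = \<phi> h"
        unfolding fixator_def by blast
      have ha: "h \<in> aut T arev" "\<phi> h \<in> aut T arev" using h Aa Ba \<phi>B by blast+
      let ?k = "inv\<^bsub>Aut\<^esub> g \<otimes>\<^bsub>Aut\<^esub> (h \<otimes>\<^bsub>Aut\<^esub> g)"
      have hg: "h \<otimes>\<^bsub>Aut\<^esub> g \<in> A" using subgroup.m_closed[OF A(1)] h g by auto
      then have kA: "?k \<in> A"
        using subgroup.m_closed[OF A(1)] subgroup.m_inv_closed[OF A(1)] g by auto
      have "fst ?k x = x" using ga ha h x by simp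
      then have "\<phi> ?k \<in> fixator {\<alpha> x} B" using kA \<alpha>[OF x] by (auto simp: fixator_def)
      then have k: "fst (\<phi> ?k) (\<alpha> x) = \<alpha> x" "\<phi> ?k \<in> aut T arev"
        using Ba by (auto simp: fixator_def)
      have "g \<otimes>\<^bsub>Aut\<^esub> ?k = h \<otimes>\<^bsub>Aut\<^esub> g" by (rule aut_eqI) (use ga ha in auto)
      then have "\<phi> g \<otimes>\<^bsub>Aut\<^esub> \<phi> ?k = \<phi> h \<otimes>\<^bsub>Aut\<^esub> \<phi> g"
        using mult[OF g kA] mult[OF h(1) g] by simp
      then have "fst (\<phi> g \<otimes>\<^bsub>Aut\<^esub> \<phi> ?k) (\<alpha> x) = fst (\<phi> h \<otimes>\<^bsub>Aut\<^esub> \<phi> g) (\<alpha> x)" by simp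
      then have "fst (\<phi> h) (fst (\<phi> g) (\<alpha> x)) = fst (\<phi> g) (\<alpha> x)"
        using k ga ha \<alpha>[OF x] by simp
      then show "h' \<in> fixator {fst (\<phi> g) (\<alpha> x)} B" using h \<phi>B by (simp add: fixator_def)
    qed
    then show ?thesis using \<alpha>_unique[OF gx] ga \<alpha>[OF x] by simp
  qed
  have "D (\<alpha> x) (\<alpha> y) = D x y" if x: "x \<in> V" and y: "y \<in> V" for x y
  proof -
    have "\<alpha> ` sphere x (D x y) = sphere (\<alpha> x) (D (\<alpha> x) (\<alpha> y))"
    proof
      show "\<alpha> ` sphere x (D x y) \<subseteq> sphere (\<alpha> x) (D (\<alpha> x) (\<alpha> y))"
      proof
        fix w assume "w \<in> \<alpha> ` sphere x (D x y)"
        then obtain u where u: "u \<in> V" "D x u = D x y" "w = \<alpha> u" by (auto simp: sphere_def)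
        then obtain g where g: "g \<in> A" "fst g x = x" "fst g y = u"
          using A(3) x y unfolding sphere_transitive_def by metis
        have "fst (\<phi> g) (\<alpha> x) = \<alpha> x" "fst (\<phi> g) (\<alpha> y) = w" using equi[OF g(1)] g u x y by simp_all
        moreover have "\<phi> g \<in> aut T arev" using g \<phi>B Ba by blast
        ultimately have "D (\<alpha> x) w = D (\<alpha> x) (\<alpha> y)" using aut_D[of "\<phi> g" "\<alpha> x" "\<alpha> y"] \<alpha> x y by simp
        then show "w \<in> sphere (\<alpha> x) (D (\<alpha> x) (\<alpha> y))" using u \<alpha> by (simp add: sphere_def)
      qed
      show "sphere (\<alpha> x) (D (\<alpha> x) (\<alpha> y)) \<subseteq> \<alpha> ` sphere x (D x y)"
      proof
        fix w assume "w \<in> sphere (\<alpha> x) (D (\<alpha> x) (\<alpha> y))"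
        then have w: "w \<in> V" "D (\<alpha> x) w = D (\<alpha> x) (\<alpha> y)" by (auto simp: sphere_def)
        then obtain h where h: "h \<in> B" "fst h (\<alpha> x) = \<alpha> x" "fst h (\<alpha> y) = w"
          using B(3) \<alpha> x y unfolding sphere_transitive_def by metis
        then have "h \<in> \<phi> ` fixator {x} A" using \<alpha>[OF x] by (simp add: fixator_def)
        then obtain g where g: "g \<in> A" "fst g x = x" "h = \<phi> g" by (auto simp: fixator_def)
        have ga: "g \<in> aut T arev" using g Aa by blast
        have "w = \<alpha> (fst g y)" using equi[OF g(1) y] h(3) g(3) by simp
        moreover have "fst g y \<in> sphere x (D x y)"
          using aut_D[OF ga x y] g(2) ga y by (simp add: sphere_def)
        ultimately show "w \<in> \<alpha> ` sphere x (D x y)" by blast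
      qed
    qed
    moreover have "card (\<alpha> ` sphere x (D x y)) = card (sphere x (D x y))"
      by (rule card_image[OF inj_on_subset[OF inj sphere_V]])
    ultimately have "card (sphere (\<alpha> x) (D (\<alpha> x) (\<alpha> y))) = card (sphere x (D x y))" by simp
    then show ?thesis using card_sphere_inj[OF d conjunct1[OF \<alpha>[OF x]] x] by blast
  qed
  with that bij\<alpha> equi show ?thesis by blast
qed

end


section \<open>Comparing two closures\<close>

text \<open>The fixators of the neighbourhood of radius \<open>l - 1\<close> of \<open>e\<close> in both closures lie in the generated
  groups, so they are conjugate by an isometry \<open>\<beta>\<close>, which may be chosen to preserve \<open>e\<close>. Restricted
  to larger neighbourhoods of \<open>e\<close>, they are then finite sets of the same cardinality, one contained
  in the other. Hence an element of the larger fixator agrees with elements of the smaller one on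
  arbitrarily large balls, and the closure of index \<open>l\<close> contains such limits.\<close>

lemma (in transitive_group) conjugate_plus_imp_fixator_subset:
  assumes kl: "1 \<le> k" "k \<le> l"
    and \<alpha>: "bij_betw \<alpha> V V" "\<And>x y. x \<in> V \<Longrightarrow> y \<in> V \<Longrightarrow> D (\<alpha> x) (\<alpha> y) = D x y"
    and \<phi>: "\<And>g. g \<in> Plus k (Pk k H) \<Longrightarrow> \<phi> g \<in> Plus l (Pk l H)"
      "\<And>g x. g \<in> Plus k (Pk k H) \<Longrightarrow> x \<in> V \<Longrightarrow> fst (\<phi> g) (\<alpha> x) = \<alpha> (fst g x)"
    and e: "e \<in> arcs T"
  shows "fixator (nbhd e (l - 1)) (Pk k H) \<subseteq> Pk l H"
proof
  have sub: "subgroup (Pk k H) Aut" "subgroup (Pk l H) Aut" by (rule Pk_subgroup[OF subgroup_H])+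
  let ?N = "nbhd e (l - 1)"
  let ?K = "fixator ?N (Pk k H)" and ?L = "fixator ?N (Pk l H)"
  have LK: "?L \<subseteq> ?K" using Pk_antimono[OF H_aut kl(2)] by (auto simp: fixator_def)
  have K_plus: "?K \<subseteq> Plus k (Pk k H)"
  proof -
    have "?K = fixator ?N (Plus k (Pk k H))" using fixator_plus[OF sub(1) e] kl by simp
    also have "\<dots> \<subseteq> Plus k (Pk k H)" unfolding fixator_def by blast
    finally show ?thesis .
  qed
  have xy: "tail T e \<in> V" "head T e \<in> V" "D (tail T e) (head T e) = 1" using e D_arc by auto
  have \<alpha>V: "\<alpha> x \<in> V" if "x \<in> V" for x using \<alpha>(1) that by (auto simp: bij_betw_def)
  obtain h where h: "h \<in> H" "fst h (\<alpha> (tail T e)) = tail T e" "fst h (\<alpha> (head T e)) = head T e"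
    using all_distance_transitive[of 1] \<alpha>V \<alpha>(2) xy unfolding distance_transitive_def by metis
  have ha: "h \<in> aut T arev" using h(1) H_aut by blast
  \<comment> \<open>The isometry \<open>\<alpha>\<close> may move \<open>e\<close>; edge-transitivity of \<open>H\<close> brings it back.\<close>
  define \<beta> where "\<beta> x = fst h (\<alpha> x)" for x
  have \<beta>V: "\<beta> x \<in> V" if "x \<in> V" for x using \<alpha>V[OF that] ha by (simp add: \<beta>_def)
  have \<beta>D: "D (\<beta> x) (\<beta> y) = D x y" if "x \<in> V" "y \<in> V" for x y
    using that ha \<alpha>V \<alpha>(2) by (simp add: \<beta>_def)
  have \<beta>_inj: "\<beta> x = \<beta> y \<longleftrightarrow> x = y" if "x \<in> V" "y \<in> V" for x y
    using \<beta>D[OF that] D_eq_0 \<beta>V that by metis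
  have \<beta>_surj: "\<exists>x \<in> V. y = \<beta> x" if y: "y \<in> V" for y
  proof -
    have "fst (inv\<^bsub>Aut\<^esub> h) y \<in> \<alpha> ` V" using \<alpha>(1) ha y by (simp add: bij_betw_def)
    then obtain x where "x \<in> V" "fst (inv\<^bsub>Aut\<^esub> h) y = \<alpha> x" by blast
    then show ?thesis using aut_inv(2)[OF ha y] by (auto simp: \<beta>_def)
  qed
  have \<beta>e: "\<beta> (tail T e) = tail T e" "\<beta> (head T e) = head T e" using h by (simp_all add: \<beta>_def)
  have \<beta>_nbhd: "\<beta> x \<in> nbhd e n \<longleftrightarrow> x \<in> nbhd e n" if x: "x \<in> V" for x n
    using \<beta>D[OF xy(1) x] \<beta>D[OF xy(2) x] \<beta>V[OF x] x by (simp add: nbhd_def ball_def \<beta>e)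
  define \<kappa> where "\<kappa> g = h \<otimes>\<^bsub>Aut\<^esub> \<phi> g \<otimes>\<^bsub>Aut\<^esub> inv\<^bsub>Aut\<^esub> h" for g
  have hl: "h \<in> Pk l H" using h(1) Pk_superset[OF H_aut] by blast
  have \<phi>l: "\<phi> g \<in> Pk l H" "\<phi> g \<in> aut T arev" if g: "g \<in> ?K" for g
  proof -
    have "\<phi> g \<in> Plus l (Pk l H)" using \<phi>(1) K_plus g by blast
    then show "\<phi> g \<in> Pk l H" using plus_subset[OF sub(2)] by blast
    then show "\<phi> g \<in> aut T arev" using Pk_aut by blast
  qed
  have \<kappa>_apply: "fst (\<kappa> g) (\<beta> x) = \<beta> (fst g x)" if g: "g \<in> ?K" and x: "x \<in> V" for g x
  proof -
    have "fst (\<phi> g) (\<alpha> x) = \<alpha> (fst g x)" using \<phi>(2) K_plus g x by blast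
    then show ?thesis using \<phi>l(2)[OF g] ha \<alpha>V[OF x] by (simp add: \<kappa>_def \<beta>_def)
  qed
  have \<kappa>L: "\<kappa> g \<in> ?L" if g: "g \<in> ?K" for g
    unfolding fixator_def
  proof (intro CollectI conjI ballI)
    show "\<kappa> g \<in> Pk l H"
      unfolding \<kappa>_def using hl \<phi>l(1)[OF g] subgroup.m_closed[OF sub(2)] subgroup.m_inv_closed[OF sub(2)]
      by simp
    fix y assume y: "y \<in> ?N"
    then obtain x where x: "x \<in> V" "y = \<beta> x" using \<beta>_surj nbhd_V by blast
    then have "fst g x = x" using y \<beta>_nbhd g by (simp add: fixator_def)
    then show "fst (\<kappa> g) y = y" using \<kappa>_apply[OF g x(1)] x(2) by simp
  qed
  \<comment> \<open>Conjugation by \<open>\<beta>\<close> injects the finitely many restrictions of \<open>?K\<close> into those of its subset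
    \<open>?L\<close>, so that both have the same restrictions.\<close>
  have restrictions: "\<exists>b \<in> ?L. \<forall>v \<in> nbhd e n. fst g v = fst b v" if g: "g \<in> ?K" for g n
  proof -
    define \<rho> where "\<rho> g = restrict (fst g) (nbhd e n)" for g :: "('v \<Rightarrow> 'v) \<times> ('e \<Rightarrow> 'e)"
    have fin: "finite (\<rho> ` ?K)"
      unfolding \<rho>_def
    proof (rule finite_restrictions[OF nbhd_V finite_nbhd[OF e] xy(1)])
      show "?K \<subseteq> aut T arev" using Pk_aut by (auto simp: fixator_def)
      show "fst g (tail T e) = tail T e" if "g \<in> ?K" for g
        using that nbhd_ends[OF e] by (simp add: fixator_def)
    qed
    have "inj_on (\<lambda>t. \<rho> (\<kappa> (inv_into ?K \<rho> t))) (\<rho> ` ?K)"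
    proof (rule inj_onI)
      fix s t assume st: "s \<in> \<rho> ` ?K" "t \<in> \<rho> ` ?K"
        and eq: "\<rho> (\<kappa> (inv_into ?K \<rho> s)) = \<rho> (\<kappa> (inv_into ?K \<rho> t))"
      define a b where "a = inv_into ?K \<rho> s" and "b = inv_into ?K \<rho> t"
      have ab: "a \<in> ?K" "b \<in> ?K" "\<rho> a = s" "\<rho> b = t"
        using st by (simp_all add: a_def b_def inv_into_into f_inv_into_f)
      have aa: "a \<in> aut T arev" "b \<in> aut T arev" using ab(1,2) Pk_aut by (auto simp: fixator_def)
      have "fst a v = fst b v" if v: "v \<in> nbhd e n" for v
      proof -
        have vV: "v \<in> V" using v nbhd_V by blast
        have "\<beta> v \<in> nbhd e n" using v \<beta>_nbhd vV by simp
        then have "fst (\<kappa> a) (\<beta> v) = fst (\<kappa> b) (\<beta> v)"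
          using eq unfolding \<rho>_def a_def[symmetric] b_def[symmetric] by (metis restrict_apply')
        then show ?thesis using \<kappa>_apply[OF ab(1) vV] \<kappa>_apply[OF ab(2) vV] \<beta>_inj aa vV by simp
      qed
      then have "\<rho> a = \<rho> b" unfolding \<rho>_def by (rule restrict_ext)
      then show "s = t" using ab by simp
    qed
    moreover have "(\<lambda>t. \<rho> (\<kappa> (inv_into ?K \<rho> t))) ` \<rho> ` ?K \<subseteq> \<rho> ` ?L"
      using \<kappa>L by (intro image_subsetI imageI) (meson inv_into_into)
    moreover have subL: "\<rho> ` ?L \<subseteq> \<rho> ` ?K" using LK by (rule image_mono)
    ultimately have "card (\<rho> ` ?K) \<le> card (\<rho> ` ?L)"
      using card_inj_on_le finite_subset[OF subL fin] by blast
    then have "\<rho> ` ?L = \<rho> ` ?K" using card_seteq[OF fin subL] by blast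
    then obtain b where b: "b \<in> ?L" "\<rho> g = \<rho> b" using g by blast
    then have "\<forall>v \<in> nbhd e n. fst g v = fst b v" unfolding \<rho>_def by (metis restrict_apply')
    with b(1) show ?thesis by blast
  qed
  fix g assume g: "g \<in> ?K"
  show "g \<in> Pk l H"
  proof (rule Pk_closed[OF H_aut])
    show "g \<in> aut T arev" using g Pk_aut by (auto simp: fixator_def)
    fix x assume x: "x \<in> V"
    obtain b where b: "b \<in> ?L" "\<forall>v \<in> nbhd e (D (tail T e) x + l). fst g v = fst b v"
      using restrictions[OF g] by blast
    then have "\<forall>v \<in> ball x l. fst g v = fst b v" using ball_subset_nbhd[OF e x] by blast
    with b(1) show "\<exists>h \<in> Pk l H. \<forall>v \<in> ball x l. fst g v = fst h v" unfolding fixator_def by blast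
  qed
qed

lemma (in transitive_group) Pk_eq_of_top_group_isomorphic:
  assumes d: "d \<ge> 3" and kl: "1 \<le> k" "k \<le> l"
    and iso: "top_group_isomorphic
      (Aut \<lparr>carrier := Plus k (Pk k H)\<rparr>) (perm_topology T (Plus k (Pk k H)))
      (Aut \<lparr>carrier := Plus l (Pk l H)\<rparr>) (perm_topology T (Plus l (Pk l H)))"
  shows "Pk k H = Pk l H"
proof -
  let ?A = "Plus k (Pk k H)" and ?B = "Plus l (Pk l H)"
  obtain \<phi> where \<phi>: "\<phi> \<in> iso (Aut\<lparr>carrier := ?A\<rparr>) (Aut\<lparr>carrier := ?B\<rparr>)"
    "homeomorphic_map (perm_topology T ?A) (perm_topology T ?B) \<phi>"
    using iso unfolding top_group_isomorphic_def by blast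
  have "1 \<le> l" using kl by simp
  obtain \<alpha> where \<alpha>: "bij_betw \<alpha> V V" "\<And>x y. x \<in> V \<Longrightarrow> y \<in> V \<Longrightarrow> D (\<alpha> x) (\<alpha> y) = D x y"
    "\<And>g x. g \<in> ?A \<Longrightarrow> x \<in> V \<Longrightarrow> fst (\<phi> g) (\<alpha> x) = \<alpha> (fst g x)"
    using topological_isomorphism_induced[OF plus_subgroup[OF Pk_aut] type_preserving_plus[OF Pk_aut]
        sphere_transitive_plus[OF kl(1) d] plus_subgroup[OF Pk_aut] type_preserving_plus[OF Pk_aut]
        sphere_transitive_plus[OF \<open>1 \<le> l\<close> d] d \<phi>] by metis
  have "\<phi> g \<in> ?B" if "g \<in> ?A" for g
    using \<phi>(1) that by (auto simp: iso_def hom_def)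
  note * = conjugate_plus_imp_fixator_subset[OF kl \<alpha>(1,2) this \<alpha>(3)]
  show ?thesis
    by (rule Pk_eqI[OF subgroup_H kl]) (use d * in auto)
qed

theorem theorem4p34:
  fixes T :: "('v, 'e) pre_digraph" and arev :: "'e \<Rightarrow> 'e" and d :: nat
    and \<Omega> :: "'a set" and F :: "('a \<Rightarrow> 'a) set"
    and H :: "(('v \<Rightarrow> 'v) \<times> ('e \<Rightarrow> 'e)) set" and k l :: nat
  assumes "finite \<Omega>" and "card \<Omega> = d" and "d \<ge> 3"
    and "regular_tree T arev d"
    and "subgroup F (BijGroup \<Omega>)"
    and "subgroup H (aut_group T arev)"
    and "perm_topology T H \<noteq> discrete_topology H"
    and "locally_perm_isomorphic T H \<Omega> F"
    and "\<exists>g \<in> H. involutive_inversion T arev g"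
    and "transitive_on \<Omega> F"
    and "\<And>\<omega> N. \<omega> \<in> \<Omega> \<Longrightarrow> subnormal N (BijGroup \<Omega> \<lparr>carrier := point_stab F \<omega>\<rparr>) \<Longrightarrow>
           N \<noteq> {\<one>\<^bsub>BijGroup \<Omega>\<^esub>} \<Longrightarrow> transitive_on (\<Omega> - {\<omega>}) N"
    and "k \<ge> 1" and "l \<ge> 1"
    and "Pk_closure T arev k H \<noteq> Pk_closure T arev l H"
  shows "\<not> top_group_isomorphic
    (aut_group T arev \<lparr>carrier := plus_k T arev k (Pk_closure T arev k H)\<rparr>)
    (perm_topology T (plus_k T arev k (Pk_closure T arev k H)))
    (aut_group T arev \<lparr>carrier := plus_k T arev l (Pk_closure T arev l H)\<rparr>)
    (perm_topology T (plus_k T arev l (Pk_closure T arev l H)))"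
proof
  interpret regular_tree T arev d by fact
  interpret transitive_group T arev d H
  proof (intro transitive_group.intro transitive_group_axioms.intro)
    show "\<exists>h \<in> H. fst h x = x \<and> fst h u = w" if "x \<in> V" "u \<in> sphere x 1" "w \<in> sphere x 1" for x u w
      using local_transitive[OF assms(8,10) subgroup_aut[OF assms(6)] that] by blast
    show "\<exists>h \<in> H. \<exists>e \<in> arcs T. snd h e = arev e"
      using assms(9) by (auto simp: involutive_inversion_def)
    show "\<exists>x \<in> V. \<exists>y \<in> V. D x y \<ge> n \<and>
      (\<forall>w \<in> forward x y. \<forall>w' \<in> forward x y. \<exists>g \<in> fixator (ball x (D x y)) H. fst g w = w')" for n
    proof -
      obtain x y where "x \<in> V" "y \<in> V" "D x y \<ge> n"
        "\<And>w w'. w \<in> forward x y \<Longrightarrow> w' \<in> forward x y \<Longrightarrow> \<exists>g \<in> fixator (ball x (D x y)) H. fst g w = w'"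
        using large_transitive_fixator[OF assms(6,5,7,8,11)] by blast
      then show ?thesis by blast
    qed
  qed fact+
  let ?A = "\<lambda>k. Plus k (Pk k H)"
  assume iso: "top_group_isomorphic (Aut \<lparr>carrier := ?A k\<rparr>) (perm_topology T (?A k))
    (Aut \<lparr>carrier := ?A l\<rparr>) (perm_topology T (?A l))"
  have "group (Aut \<lparr>carrier := ?A k\<rparr>)"
    by (rule group.subgroup_imp_group[OF group_Aut plus_subgroup[OF Pk_aut]])
  then have "top_group_isomorphic (Aut \<lparr>carrier := ?A l\<rparr>) (perm_topology T (?A l))
    (Aut \<lparr>carrier := ?A k\<rparr>) (perm_topology T (?A k))"
    using top_group_isomorphic_sym[OF iso] by simp
  with iso assms(3,12-14) show False
    using Pk_eq_of_top_group_isomorphic by (metis nle_le)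
qed

end
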